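(* Let $G$ be a Lie group with Lie algebra $\mathbf{g}$, let $l:\mathbf{g}\to\mathbb{R}$ be a smooth function and let $f:\mathbf{g}\times\mathbf{g}\to\mathbf{g}^*$ be a force field with delay. The solutions $\xi(t)$ of the Euler–Poincaré equations with forcing with delay $$\frac{d}{dt}\left(\frac{\partial l}{\partial\xi}\right)-\mathrm{ad}^*_\xi\frac{\partial l}{\partial\xi}=f(\xi,\tilde\xi),\qquad \tilde\xi(t)=\xi(t-\tau),$$ preserve the coadjoint orbits of $\mathbf{g}^*$ provided the force field with delay $f$ is given by $$f(\xi,\tilde\xi)=\mathrm{ad}^*_{\eta(\xi,\tilde\xi)}\frac{\partial l}{\partial\xi}(\xi)$$ for some smooth map $\eta:\mathbf{g}\times\mathbf{g}\to\mathbf{g}$.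
   Context: The coadjoint operator is $\langle\mathrm{ad}^*_\xi\mu,\zeta\rangle=\langle\mu,[\xi,\zeta]\rangle$ for $\xi,\zeta\in\mathbf{g}$, $\mu\in\mathbf{g}^*$; $\frac{\partial l}{\partial\xi}(\xi)\in\mathbf{g}^*$ is the derivative of $l$ at $\xi$; $\tau\ge0$ is the delay, and solutions are continuous curves on $[-\tau,\alpha)$, $\alpha>0$, satisfying the equation for $t\in[0,\alpha)$. That solutions preserve the coadjoint orbits of $\mathbf{g}^*$ means that for each solution the curve $\mu(t)=\frac{\partial l}{\partial\xi}(\xi(t))$, $t\in[0,\alpha)$, stays in a single coadjoint orbit of $G$ in $\mathbf{g}^*$. *)

theory Defs
  imports "HOL-Analysis.Analysis" "HOL-Algebra.Group"
begin

section \<open>Smooth maps\<close>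

text \<open>
  Iterated directional derivatives on an open set \<open>S\<close>.  All domains below are finite-dimensional,
  so continuity of every directional derivative of order \<open>k\<close> is the usual notion of class \<open>C\<^sup>k\<close>.
\<close>

primrec Ck_on :: "nat \<Rightarrow> 'a set \<Rightarrow> ('a::real_normed_vector \<Rightarrow> 'b::real_normed_vector) \<Rightarrow> bool" where
  "Ck_on 0 S f \<longleftrightarrow> continuous_on S f"
| "Ck_on (Suc k) S f \<longleftrightarrow>
     (\<forall>x\<in>S. f differentiable (at x)) \<and> (\<forall>v. Ck_on k S (\<lambda>x. frechet_derivative f (at x) v))"

definition smooth_on :: "'a set \<Rightarrow> ('a::real_normed_vector \<Rightarrow> 'b::real_normed_vector) \<Rightarrow> bool" where
  "smooth_on S f \<longleftrightarrow> (\<forall>k. Ck_on k S f)"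

section \<open>Smooth manifolds\<close>

text \<open>A chart is a pair of its domain and its coordinate map; the values of the coordinate map
  outside the domain carry no meaning.\<close>

type_synonym ('m, 'e) chart = "'m set \<times> ('m \<Rightarrow> 'e)"

definition is_chart :: "'m topology \<Rightarrow> ('m, 'e::real_normed_vector) chart \<Rightarrow> bool" where
  "is_chart T = (\<lambda>(U, \<phi>). openin T U \<and> open (\<phi> ` U) \<and>
     homeomorphic_map (subtopology T U) (top_of_set (\<phi> ` U)) \<phi>)"

definition smoothly_compatible ::
    "('m, 'e::real_normed_vector) chart \<Rightarrow> ('m, 'e) chart \<Rightarrow> bool" where
  "smoothly_compatible = (\<lambda>(U, \<phi>) (V, \<psi>).
     smooth_on (\<phi> ` (U \<inter> V)) (\<psi> \<circ> inv_into U \<phi>) \<and>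
     smooth_on (\<psi> ` (U \<inter> V)) (\<phi> \<circ> inv_into V \<psi>))"

text \<open>A smooth structure is a maximal smooth atlas: membership implies pairwise compatibility
  (left to right) and every chart compatible with the whole atlas belongs to it (right to left).\<close>

definition smooth_structure :: "'m topology \<Rightarrow> ('m, 'e::real_normed_vector) chart set \<Rightarrow> bool" where
  "smooth_structure T A \<longleftrightarrow>
     (\<Union>(U, \<phi>)\<in>A. U) = topspace T \<and>
     (\<forall>c. c \<in> A \<longleftrightarrow> is_chart T c \<and> (\<forall>d\<in>A. smoothly_compatible c d))"

text \<open>The product atlas below is not maximal; for smoothness of maps any atlas of the smooth
  structure suffices.\<close>

definition product_atlas ::
    "('m, 'e) chart set \<Rightarrow> ('n, 'f) chart set \<Rightarrow> ('m \<times> 'n, 'e \<times> 'f) chart set" where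
  "product_atlas A B = {(U \<times> V, map_prod \<phi> \<psi>) | U \<phi> V \<psi>. (U, \<phi>) \<in> A \<and> (V, \<psi>) \<in> B}"

definition smooth_map ::
    "'m topology \<Rightarrow> ('m, 'e::real_normed_vector) chart set \<Rightarrow>
     'n topology \<Rightarrow> ('n, 'f::real_normed_vector) chart set \<Rightarrow> ('m \<Rightarrow> 'n) \<Rightarrow> bool" where
  "smooth_map T A T' B h \<longleftrightarrow> continuous_map T T' h \<and>
     (\<forall>(U, \<phi>)\<in>A. \<forall>(V, \<psi>)\<in>B. smooth_on (\<phi> ` {x \<in> U. h x \<in> V}) (\<psi> \<circ> h \<circ> inv_into U \<phi>))"

text \<open>The tangent map of \<open>h\<close> at \<open>p\<close>, in the coordinates given by a chart \<open>c\<close> around \<open>p\<close> and a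
  chart \<open>d\<close> around \<open>h p\<close>.\<close>

definition tangent_map ::
    "('m, 'e::real_normed_vector) chart \<Rightarrow> ('n, 'f::real_normed_vector) chart \<Rightarrow>
     ('m \<Rightarrow> 'n) \<Rightarrow> 'm \<Rightarrow> 'e \<Rightarrow> 'f" where
  "tangent_map c d h p =
     frechet_derivative (snd d \<circ> h \<circ> inv_into (fst c) (snd c)) (at (snd c p))"

section \<open>Lie groups\<close>

text \<open>The model space is an arbitrary finite-dimensional normed space (completeness is then
  automatic).  The class \<open>euclidean_space\<close> would exclude Lie groups of dimension zero.\<close>

locale lie_group = group G
  for G :: "('g, 'x) monoid_scheme" (structure) +
  fixes T :: "'g topology"
    and A :: "('g, 'e::banach) chart set"
  assumes finite_dim: "\<exists>B :: 'e set. finite B \<and> span B = UNIV"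
    and topspace_eq: "topspace T = carrier G"
    and Hausdorff: "Hausdorff_space T"
    and second_countable: "second_countable T"
    and smooth_structure: "smooth_structure T A"
    and smooth_mult:
      "smooth_map (prod_topology T T) (product_atlas A A) T A (\<lambda>(x, y). x \<otimes> y)"
    and smooth_inv: "smooth_map T A T A (\<lambda>x. inv x)"

section \<open>Lie algebra, adjoint and coadjoint action\<close>

text \<open>
  The Lie algebra \<open>\<g>\<close> of \<open>G\<close> is the tangent space at the identity.  A chart \<open>c = (U, \<phi>)\<close> with
  \<open>\<one> \<in> U\<close> identifies it with the model space \<open>'e\<close> through the differential of \<open>\<phi>\<close> at \<open>\<one>\<close>, and
  elements of \<open>\<g>\<close> are represented by vectors of \<open>'e\<close> in this way.  As the atlas is maximal, every
  linear isomorphism between the tangent space and \<open>'e\<close> is the differential of such a chart.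

  The bracket is that of left-invariant vector fields, evaluated at the identity.  The field
  generated by \<open>\<xi>\<close> has the value \<open>T\<^sub>\<one>L\<^sub>g \<xi>\<close> at \<open>g\<close>; it is expressed below as a function of
  the coordinates of \<open>g\<close>.
\<close>

definition left_invariant_field ::
    "('g, 'x) monoid_scheme \<Rightarrow> ('g, 'e::banach) chart \<Rightarrow> 'e \<Rightarrow> 'e \<Rightarrow> 'e" where
  "left_invariant_field G c \<xi> a =
     tangent_map c c (\<lambda>h. inv_into (fst c) (snd c) a \<otimes>\<^bsub>G\<^esub> h) \<one>\<^bsub>G\<^esub> \<xi>"

definition vector_field_bracket :: "('e \<Rightarrow> 'e) \<Rightarrow> ('e \<Rightarrow> 'e) \<Rightarrow> 'e \<Rightarrow> 'e::real_normed_vector" where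
  "vector_field_bracket X Y a =
     frechet_derivative Y (at a) (X a) - frechet_derivative X (at a) (Y a)"

definition lie_bracket ::
    "('g, 'x) monoid_scheme \<Rightarrow> ('g, 'e::banach) chart \<Rightarrow> 'e \<Rightarrow> 'e \<Rightarrow> 'e" where
  "lie_bracket G c \<xi> \<zeta> =
     vector_field_bracket (left_invariant_field G c \<xi>) (left_invariant_field G c \<zeta>)
       (snd c \<one>\<^bsub>G\<^esub>)"

definition Ad :: "('g, 'x) monoid_scheme \<Rightarrow> ('g, 'e::banach) chart \<Rightarrow> 'g \<Rightarrow> 'e \<Rightarrow> 'e" where
  "Ad G c g = tangent_map c c (\<lambda>h. g \<otimes>\<^bsub>G\<^esub> h \<otimes>\<^bsub>G\<^esub> inv\<^bsub>G\<^esub> g) \<one>\<^bsub>G\<^esub>"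

text \<open>The dual \<open>\<g>\<^sup>*\<close> is \<open>'e \<Rightarrow>\<^sub>L real\<close>.  In a Lie group all arguments of \<open>Blinfun\<close> below are
  linear, hence bounded since \<open>'e\<close> is finite-dimensional.\<close>

definition Ad_star ::
    "('g, 'x) monoid_scheme \<Rightarrow> ('g, 'e::banach) chart \<Rightarrow> 'g \<Rightarrow> ('e \<Rightarrow>\<^sub>L real) \<Rightarrow> ('e \<Rightarrow>\<^sub>L real)" where
  "Ad_star G c g \<mu> = Blinfun (\<lambda>\<zeta>. blinfun_apply \<mu> (Ad G c (inv\<^bsub>G\<^esub> g) \<zeta>))"

definition coadjoint_orbit ::
    "('g, 'x) monoid_scheme \<Rightarrow> ('g, 'e::banach) chart \<Rightarrow> ('e \<Rightarrow>\<^sub>L real) \<Rightarrow> ('e \<Rightarrow>\<^sub>L real) set" where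
  "coadjoint_orbit G c \<mu> = (\<lambda>g. Ad_star G c g \<mu>) ` carrier G"

definition ad_star ::
    "('g, 'x) monoid_scheme \<Rightarrow> ('g, 'e::banach) chart \<Rightarrow> 'e \<Rightarrow> ('e \<Rightarrow>\<^sub>L real) \<Rightarrow> ('e \<Rightarrow>\<^sub>L real)" where
  "ad_star G c \<xi> \<mu> = Blinfun (\<lambda>\<zeta>. blinfun_apply \<mu> (lie_bracket G c \<xi> \<zeta>))"

section \<open>Euler-Poincare equations with forcing with delay\<close>

definition momentum :: "('e::real_normed_vector \<Rightarrow> real) \<Rightarrow> 'e \<Rightarrow> ('e \<Rightarrow>\<^sub>L real)" where
  "momentum l \<xi> = Blinfun (frechet_derivative l (at \<xi>))"

text \<open>The derivative is taken within \<open>[0, \<alpha>)\<close>: it is one-sided at time 0, where the equation takes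
  over from the initial history on \<open>[-\<tau>, 0]\<close>, and two-sided at later times.\<close>

definition euler_poincare_delay_solution ::
    "('g, 'x) monoid_scheme \<Rightarrow> ('g, 'e::banach) chart \<Rightarrow> ('e \<Rightarrow> real) \<Rightarrow>
     ('e \<times> 'e \<Rightarrow> ('e \<Rightarrow>\<^sub>L real)) \<Rightarrow> real \<Rightarrow> real \<Rightarrow> (real \<Rightarrow> 'e) \<Rightarrow> bool" where
  "euler_poincare_delay_solution G c l f \<tau> \<alpha> \<xi> \<longleftrightarrow>
     continuous_on {-\<tau>..<\<alpha>} \<xi> \<and>
     (\<forall>t\<in>{0..<\<alpha>}. \<exists>D.
        ((\<lambda>s. momentum l (\<xi> s)) has_vector_derivative D) (at t within {0..<\<alpha>}) \<and>
        D - ad_star G c (\<xi> t) (momentum l (\<xi> t)) = f (\<xi> t, \<xi> (t - \<tau>)))"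

end

theory Submission
  imports Defs
begin

text \<open>
  Put \<open>\<mu>(t) = \<partial>l/\<partial>\<xi>(\<xi>(t))\<close> and \<open>\<omega>(t) = \<xi>(t) + \<eta>(\<xi>(t), \<xi>(t - \<tau>))\<close>.  Since \<open>ad\<^sup>*\<close> is linear
  in its index, the forced equation with delay is the linear equation
  \<open>\<mu>' = ad\<^sup>*\<^bsub>\<omega>(t)\<^esub> \<mu>\<close>, in which \<open>\<omega>\<close> is a given continuous curve in the Lie
  algebra.

  Such an equation is solved by the coadjoint action.  If \<open>h\<close> is a curve in the group with
  \<open>h(t\<^sub>0) = \<one>\<close> and \<open>h' = - \<omega> h\<close> (the value at \<open>h\<close> of the right-invariant field generated by
  \<open>- \<omega>\<close>), then \<open>d/dt Ad\<^bsub>h\<^esub> \<zeta> = - [\<omega>, Ad\<^bsub>h\<^esub> \<zeta>]\<close>, so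
  \<open>d/dt \<langle>\<mu>, Ad\<^bsub>h\<^esub> \<zeta>\<rangle> = \<langle>\<mu>, [\<omega>, Ad\<^bsub>h\<^esub> \<zeta>]\<rangle> - \<langle>\<mu>, [\<omega>, Ad\<^bsub>h\<^esub> \<zeta>]\<rangle> = 0\<close>
  for all \<open>\<zeta>\<close>, that is, \<open>\<mu>(t) = Ad\<^sup>*\<^bsub>h(t)\<^esub> \<mu>(t\<^sub>0)\<close>.

  Two facts carry the argument.  The first is that the bracket of left-invariant fields is the
  derivative of \<open>Ad\<close> at the identity (\<open>Ad_derivative_is_bracket\<close>).  Let \<open>L\<^sub>\<zeta>\<close> and \<open>R\<^sub>\<zeta>\<close> be the
  left- and right-invariant fields in a chart at the identity.  From
  \<open>(g h g\<^sup>-\<^sup>1) g = g h\<close> one gets \<open>R\<^bsub>Ad\<^sub>g \<zeta>\<^esub>(g) = L\<^sub>\<zeta>(g)\<close>; differentiating at \<open>g = \<one>\<close> in the direction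
  \<open>\<xi>\<close> gives \<open>D(Ad \<zeta>)\<xi> = DL\<^sub>\<zeta> \<xi> - DR\<^sub>\<zeta> \<xi>\<close>.  The derivatives \<open>DR\<^sub>\<zeta> \<xi>\<close> and \<open>DL\<^sub>\<xi> \<zeta>\<close> at the identity
  are the two mixed second derivatives of the multiplication, hence equal, and
  \<open>DL\<^sub>\<zeta> \<xi> - DL\<^sub>\<xi> \<zeta>\<close> is the bracket.  At other points the derivative of \<open>Ad\<close> along a curve is
  reduced to this one by \<open>Ad\<^bsub>g k\<^esub> = Ad\<^sub>g Ad\<^sub>k\<close> (\<open>Ad_along_right_invariant_curve\<close>).

  The second fact is the existence of \<open>h\<close>.  Near the identity the Picard-Lindeloef theorem applies
  in a single chart, for a time \<open>\<delta>\<close> that depends only on a bound for \<open>\<omega>\<close>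
  (\<open>coadjoint_flow_short_time\<close>).  As \<open>h\<close> may be restarted at \<open>\<one>\<close> at any time and
  \<open>Ad\<^sup>*\<close> is an action, finitely many steps of length at most \<open>\<delta>\<close> reach any given time without
  leaving the orbit (\<open>coadjoint_flow_in_orbit\<close>), and no global flow on the group is required.

  The model space is a finite-dimensional normed space without a Euclidean structure, so the
  elementary finite-dimensional facts (linear maps are bounded, \<open>C\<^sup>1\<close> maps are locally Lipschitz)
  are derived from a basis first.
\<close>

section \<open>Finite-dimensional normed spaces\<close>

text \<open>The parallelotope spanned by \<open>insert a B\<close> is the sum of a segment and the one spanned by
  \<open>B\<close>, so compactness passes up by induction.\<close>
lemma compact_bounded_combinations:
  fixes B :: "'e::real_normed_vector set"
  assumes "finite B"
  shows "compact {\<Sum>b\<in>B. u b *\<^sub>R b | u::'e \<Rightarrow> real. \<forall>b\<in>B. \<bar>u b\<bar> \<le> (1::real)}"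
  using assms
proof (induction B)
  case empty
  then show ?case by simp
next
  case (insert a B)
  let ?K = "\<lambda>B::'e set. {\<Sum>b\<in>B. u b *\<^sub>R b | u::'e \<Rightarrow> real. \<forall>b\<in>B. \<bar>u b\<bar> \<le> (1::real)}"
  have "compact ((\<lambda>t::real. t *\<^sub>R a) ` {-1..1})"
    by (intro compact_continuous_image continuous_intros) auto
  then have "compact {x + y | x y. x \<in> (\<lambda>t::real. t *\<^sub>R a) ` {-1..1} \<and> y \<in> ?K B}"
    by (rule compact_sums) (rule insert.IH)
  also have "{x + y | x y. x \<in> (\<lambda>t::real. t *\<^sub>R a) ` {-1..1} \<and> y \<in> ?K B} = ?K (insert a B)"
  proof (intro subset_antisym subsetI)
    fix z assume "z \<in> {x + y | x y. x \<in> (\<lambda>t::real. t *\<^sub>R a) ` {-1..1} \<and> y \<in> ?K B}"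
    then obtain t u where tu: "z = t *\<^sub>R a + (\<Sum>b\<in>B. u b *\<^sub>R b)" "\<bar>t\<bar> \<le> 1" "\<forall>b\<in>B. \<bar>u b\<bar> \<le> 1"
      by (auto simp: abs_le_iff)
    have "(\<Sum>b\<in>B. u b *\<^sub>R b) = (\<Sum>b\<in>B. (u(a := t)) b *\<^sub>R b)"
      using insert.hyps by (intro sum.cong) auto
    then have "z = (\<Sum>b\<in>insert a B. (u(a := t)) b *\<^sub>R b)"
      using tu insert.hyps by simp
    moreover have "\<forall>b\<in>insert a B. \<bar>(u(a := t)) b\<bar> \<le> 1"
      using tu by auto
    ultimately show "z \<in> ?K (insert a B)"
      by blast
  next
    fix z assume "z \<in> ?K (insert a B)"
    then obtain u where u: "z = (\<Sum>b\<in>insert a B. u b *\<^sub>R b)" "\<forall>b\<in>insert a B. \<bar>u b\<bar> \<le> 1"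
      by blast
    then have "z = u a *\<^sub>R a + (\<Sum>b\<in>B. u b *\<^sub>R b)" using insert.hyps by simp
    moreover have "u a *\<^sub>R a \<in> (\<lambda>t::real. t *\<^sub>R a) ` {-1..1}"
      using u by (auto simp: abs_le_iff)
    ultimately show "z \<in> {x + y | x y. x \<in> (\<lambda>t::real. t *\<^sub>R a) ` {-1..1} \<and> y \<in> ?K B}"
      using u by blast
  qed
  finally show ?case .
qed

text \<open>Scaling a combination by its coefficient of largest modulus puts it on a face of the
  parallelotope, where some coefficient is 1.  The union of the faces is compact and, by
  independence, misses 0; hence it keeps a distance \<open>d > 0\<close> from 0.\<close>
lemma independent_coefficients_bounded:
  fixes B :: "'e::real_normed_vector set"
  assumes "finite B" "independent B"
  obtains d where "d > 0" "\<And>u a. a \<in> B \<Longrightarrow> d * \<bar>u a\<bar> \<le> norm (\<Sum>b\<in>B. u b *\<^sub>R b)"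
proof -
  let ?K = "\<lambda>B::'e set. {\<Sum>b\<in>B. u b *\<^sub>R b | u::'e \<Rightarrow> real. \<forall>b\<in>B. \<bar>u b\<bar> \<le> (1::real)}"
  define S where "S = (\<Union>a\<in>B. (+) a ` ?K (B - {a}))"
  have "compact S"
    unfolding S_def using assms(1)
    by (intro compact_UN compact_translation compact_bounded_combinations) auto
  moreover have "0 \<notin> S"
  proof
    assume "0 \<in> S"
    then obtain a u where a: "a \<in> B" "0 = a + (\<Sum>b\<in>B - {a}. u b *\<^sub>R b)"
      unfolding S_def by auto
    then have "a = - (\<Sum>b\<in>B - {a}. u b *\<^sub>R b)" by (simp add: eq_neg_iff_add_eq_0)
    also have "\<dots> \<in> span (B - {a})"
      by (intro span_neg span_sum span_scale span_base) auto
    finally show False using a assms(2) dependent_def by blast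
  qed
  ultimately have "open (- S)" "0 \<in> - S"
    by (auto simp: compact_imp_closed)
  then obtain d where d: "d > 0" "ball 0 d \<subseteq> - S"
    using open_contains_ball by blast
  show thesis
  proof (rule that[OF d(1)])
    fix u :: "'e \<Rightarrow> real" and a assume "a \<in> B"
    define m where "m = Max ((\<lambda>b. \<bar>u b\<bar>) ` B)"
    have m: "\<And>b. b \<in> B \<Longrightarrow> \<bar>u b\<bar> \<le> m" unfolding m_def using assms by simp
    have "m \<in> (\<lambda>b. \<bar>u b\<bar>) ` B" unfolding m_def using assms \<open>a \<in> B\<close> by (intro Max_in) auto
    then obtain c where c: "c \<in> B" "\<bar>u c\<bar> = m" by auto
    let ?x = "\<Sum>b\<in>B. u b *\<^sub>R b"
    have "d * m \<le> norm ?x"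
    proof (cases "m = 0")
      case False
      then have nz: "u c \<noteq> 0" and mp: "m > 0" using c by auto
      have "inverse (u c) *\<^sub>R ?x = (\<Sum>b\<in>B. (inverse (u c) * u b) *\<^sub>R b)"
        by (simp add: scaleR_sum_right)
      also have "\<dots> = c + (\<Sum>b\<in>B - {c}. (inverse (u c) * u b) *\<^sub>R b)"
        using c nz assms(1) by (subst sum.remove[of _ c]) auto
      finally have eq: "inverse (u c) *\<^sub>R ?x = \<dots>" .
      have "\<forall>b\<in>B - {c}. \<bar>inverse (u c) * u b\<bar> \<le> 1"
        using m mp c by (auto simp: abs_mult divide_simps)
      then have "(\<Sum>b\<in>B - {c}. (inverse (u c) * u b) *\<^sub>R b) \<in> ?K (B - {c})"
        by (intro CollectI exI[of _ "\<lambda>b. inverse (u c) * u b"]) auto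
      then have "inverse (u c) *\<^sub>R ?x \<in> S"
        unfolding S_def eq by (intro UN_I[OF c(1)]) (rule imageI)
      then have "inverse (u c) *\<^sub>R ?x \<notin> ball 0 d" using d by blast
      then have "d \<le> inverse m * norm ?x"
        using c by simp
      then show ?thesis using mp by (simp add: field_simps)
    qed simp
    moreover have "d * \<bar>u a\<bar> \<le> d * m"
      using m[OF \<open>a \<in> B\<close>] d by simp
    ultimately show "d * \<bar>u a\<bar> \<le> norm ?x" by linarith
  qed
qed

text \<open>The bound uses only the values of \<open>f\<close> on a fixed basis, so estimates known for finitely many
  vectors become uniform in all vectors.\<close>
lemma finite_dim_linear_bound:
  fixes S :: "'e::real_normed_vector set"
  assumes "finite S" "span S = UNIV"
  obtains B :: "'e set" and C :: real
  where "finite B" "C \<ge> 0"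
    "\<And>(f::'e \<Rightarrow> 'f::real_normed_vector) x. linear f \<Longrightarrow> norm (f x) \<le> C * (\<Sum>b\<in>B. norm (f b)) * norm x"
proof -
  obtain B where B: "B \<subseteq> S" "independent B" "S \<subseteq> span B"
    using maximal_independent_subset by blast
  have fin: "finite B" using B assms finite_subset by blast
  have spB: "span B = UNIV"
    using B assms span_mono[OF B(3)] by (simp add: span_span top.extremum_unique)
  obtain d where d: "d > 0" "\<And>u a. a \<in> B \<Longrightarrow> d * \<bar>u a\<bar> \<le> norm (\<Sum>b\<in>B. u b *\<^sub>R b)"
    using independent_coefficients_bounded[OF fin B(2)] by blast
  show thesis
  proof (rule that[OF fin, of "inverse d"])
    fix f :: "'e \<Rightarrow> 'f" and x assume f: "linear f"
    let ?u = "representation B x"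
    have x: "(\<Sum>b\<in>B. ?u b *\<^sub>R b) = x"
      by (rule sum_representation_eq) (use B fin spB in auto)
    have u: "\<bar>?u b\<bar> \<le> inverse d * norm x" if "b \<in> B" for b
      using d(2)[OF that, of ?u] d(1) unfolding x by (simp add: field_simps)
    have "norm (f x) = norm (\<Sum>b\<in>B. ?u b *\<^sub>R f b)"
      using x f by (metis (no_types, lifting) linear_scale linear_sum sum.cong)
    also have "\<dots> \<le> (\<Sum>b\<in>B. (inverse d * norm x) * norm (f b))"
      by (rule sum_norm_le) (auto intro!: mult_right_mono u)
    finally show "norm (f x) \<le> inverse d * (\<Sum>b\<in>B. norm (f b)) * norm x"
      by (simp add: sum_distrib_left mult_ac)
  qed (use d in auto)
qed

lemma finite_dim_bounded_linear:
  fixes f :: "'e::real_normed_vector \<Rightarrow> 'f::real_normed_vector"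
  assumes "finite S" "span S = (UNIV :: 'e set)" and "linear f"
  shows "bounded_linear f"
proof -
  obtain B C where "finite B" "C \<ge> 0" and "\<And>(f::'e \<Rightarrow> 'f) x. linear f \<Longrightarrow> norm (f x) \<le> C * (\<Sum>b\<in>B. norm (f b)) * norm x"
    using finite_dim_linear_bound[OF assms(1,2)] by blast
  from this(3)[OF assms(3)] show ?thesis
    by (intro bounded_linear_intro[where K = "C * (\<Sum>b\<in>B. norm (f b))"])
      (simp_all add: linear_add[OF assms(3)] linear_scale[OF assms(3)] mult.commute)
qed

text \<open>Near \<open>x\<close> the finitely many values of the derivative on a basis are bounded by continuity, and
  they bound the operator norm; convexity of the ball does the rest.\<close>
lemma C1_imp_locally_lipschitz:
  fixes f :: "'e::real_normed_vector \<Rightarrow> 'f::real_normed_vector"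
  assumes fd: "finite S" "span S = (UNIV :: 'e set)"
    and W: "open W" "x \<in> W"
    and der: "\<And>y. y \<in> W \<Longrightarrow> (f has_derivative f' y) (at y)"
    and cont: "\<And>v. continuous_on W (\<lambda>y. f' y v)"
  obtains r L where "r > 0" "L \<ge> 0" "cball x r \<subseteq> W"
    "\<And>y z. y \<in> cball x r \<Longrightarrow> z \<in> cball x r \<Longrightarrow> norm (f y - f z) \<le> L * norm (y - z)"
proof -
  obtain B C where BC: "finite B" "C \<ge> 0"
    "\<And>(f::'e \<Rightarrow> 'f) x. linear f \<Longrightarrow> norm (f x) \<le> C * (\<Sum>b\<in>B. norm (f b)) * norm x"
    using finite_dim_linear_bound[OF fd] by blast
  define g where "g y = C * (\<Sum>b\<in>B. norm (f' y b))" for y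
  have g0: "g y \<ge> 0" for y unfolding g_def using BC by (simp add: sum_nonneg)
  have "continuous_on W g" unfolding g_def by (intro continuous_intros cont)
  then have "(g \<longlongrightarrow> g x) (at x)"
    using W continuous_on_eq_continuous_at isCont_def by blast
  then have "\<forall>\<^sub>F y in at x. g y < g x + 1" by (rule order_tendstoD) simp
  then have "\<forall>\<^sub>F y in nhds x. g y < g x + 1" unfolding eventually_at_filter
    by (rule eventually_mono) auto
  moreover have "\<forall>\<^sub>F y in nhds x. y \<in> W" using W by (simp add: eventually_nhds_in_open)
  ultimately have "\<forall>\<^sub>F y in nhds x. y \<in> W \<and> g y < g x + 1" by eventually_elim auto
  then obtain e where e: "e > 0" "\<And>y. dist y x < e \<Longrightarrow> y \<in> W \<and> g y < g x + 1"
    by (auto simp: eventually_nhds_metric)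
  show thesis
  proof (rule that[of "e/2" "g x + 1"])
    have e2: "y \<in> W" "g y \<le> g x + 1" if "y \<in> cball x (e/2)" for y
      using e(2)[of y] that e(1) by (auto simp: dist_commute)
    then show "cball x (e/2) \<subseteq> W" by auto
    fix y z assume yz: "y \<in> cball x (e/2)" "z \<in> cball x (e/2)"
    show "norm (f y - f z) \<le> (g x + 1) * norm (y - z)"
    proof (rule differentiable_bound[of "cball x (e/2)"])
      fix w assume w: "w \<in> cball x (e/2)"
      show "(f has_derivative f' w) (at w within cball x (e/2))"
        using der e2 w has_derivative_at_withinI by blast
      have "linear (f' w)" using der e2(1)[OF w] has_derivative_linear by blast
      then have "norm (f' w v) \<le> g w * norm v" for v
        unfolding g_def by (rule BC(3))
      then have "norm (f' w v) \<le> (g x + 1) * norm v" for v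
        using mult_right_mono[OF e2(2)[OF w] norm_ge_zero, of v] order_trans by blast
      then show "onorm (f' w) \<le> g x + 1" using g0[of x] by (intro onorm_bound) auto
    qed (use yz in auto)
  qed (use e g0[of x] in auto)
qed

text \<open>For finitely many maps a common radius and a common constant exist: shrink the ball and
  add the constants.\<close>
lemma C1_imp_locally_lipschitz_family:
  fixes f :: "'i \<Rightarrow> 'e::real_normed_vector \<Rightarrow> 'f::real_normed_vector"
  assumes fd: "finite S" "span S = (UNIV :: 'e set)"
    and I: "finite I" and W: "open W" "x \<in> W"
    and der: "\<And>i y. i \<in> I \<Longrightarrow> y \<in> W \<Longrightarrow> (f i has_derivative f' i y) (at y)"
    and cont: "\<And>i v. i \<in> I \<Longrightarrow> continuous_on W (\<lambda>y. f' i y v)"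
  shows "\<exists>r>0. \<exists>L\<ge>0. cball x r \<subseteq> W \<and>
    (\<forall>i\<in>I. \<forall>y\<in>cball x r. \<forall>z\<in>cball x r. norm (f i y - f i z) \<le> L * norm (y - z))"
  using I der cont
proof (induction I)
  case empty
  obtain r where "r > 0" "cball x r \<subseteq> W" using W open_contains_cball by blast
  then show ?case by (intro exI[of _ r] conjI exI[of _ 0]) auto
next
  case (insert j I)
  have "\<exists>r>0. \<exists>L\<ge>0. cball x r \<subseteq> W \<and>
      (\<forall>i\<in>I. \<forall>y\<in>cball x r. \<forall>z\<in>cball x r. norm (f i y - f i z) \<le> L * norm (y - z))"
    using insert.IH insert.prems by simp
  then obtain r L where r: "r > 0" "L \<ge> 0" "cball x r \<subseteq> W"
    "\<And>i y z. i \<in> I \<Longrightarrow> y \<in> cball x r \<Longrightarrow> z \<in> cball x r \<Longrightarrow> norm (f i y - f i z) \<le> L * norm (y - z)"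
    by (elim exE conjE) fast
  have "(f j has_derivative f' j y) (at y)" if "y \<in> W" for y using insert.prems(1) that by simp
  moreover have "continuous_on W (\<lambda>y. f' j y v)" for v using insert.prems(2) by simp
  ultimately obtain s M where s: "s > 0" "M \<ge> 0" "cball x s \<subseteq> W"
    "\<And>y z. y \<in> cball x s \<Longrightarrow> z \<in> cball x s \<Longrightarrow> norm (f j y - f j z) \<le> M * norm (y - z)"
    using C1_imp_locally_lipschitz[OF fd W, of "f j" "f' j"] by metis
  have "norm (f i y - f i z) \<le> (L + M) * norm (y - z)"
    if i: "i \<in> insert j I" and yz: "y \<in> cball x (min r s)" "z \<in> cball x (min r s)" for i y z
  proof -
    have "norm (f i y - f i z) \<le> L * norm (y - z) \<or> norm (f i y - f i z) \<le> M * norm (y - z)"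
      using i r(4)[of i y z] s(4)[of y z] yz by auto
    moreover have "0 \<le> L * norm (y - z)" "0 \<le> M * norm (y - z)" using r s by simp_all
    ultimately show ?thesis by (auto simp: distrib_right)
  qed
  then show ?case using r s by (intro exI[of _ "min r s"] conjI exI[of _ "L + M"]) auto
qed

section \<open>Derivatives: remainders and symmetry of mixed second derivatives\<close>

text \<open>In the computation of the derivative of \<open>Ad\<close>, the remainder \<open>E\<close> is shown to have derivative 0
  in this way: it is a factor \<open>\<psi>\<close> tending to 0 times the increment.\<close>
lemma has_derivative_zeroI:
  fixes E :: "'a::real_normed_vector \<Rightarrow> 'b::real_normed_vector"
  assumes "E x = 0" and le: "\<forall>\<^sub>F a in at x. norm (E a) \<le> \<psi> a * norm (a - x)"
    and "(\<psi> \<longlongrightarrow> 0) (at x)"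
  shows "(E has_derivative (\<lambda>v. 0)) (at x)"
  unfolding has_derivative_iff_norm
proof
  have "\<forall>\<^sub>F a in at x. norm (norm (E a - E x - 0) / norm (a - x)) \<le> \<psi> a"
    using le eventually_neq_at_within[of x x UNIV]
    by eventually_elim (simp add: assms(1) divide_simps)
  then show "((\<lambda>a. norm (E a - E x - 0) / norm (a - x)) \<longlongrightarrow> 0) (at x)"
    by (rule Lim_null_comparison) (rule assms(3))
qed simp

lemma vector_mean_value_bound:
  fixes f :: "real \<Rightarrow> 'a::real_normed_vector"
  assumes "a \<le> b"
    and "\<And>t. t \<in> {a..b} \<Longrightarrow> (f has_vector_derivative f' t) (at t)"
    and "\<And>t. t \<in> {a..b} \<Longrightarrow> norm (f' t) \<le> K"
  shows "norm (f b - f a) \<le> K * (b - a)"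
proof -
  have "norm (f b - f a) \<le> K * norm (b - a)"
  proof (rule differentiable_bound[of "{a..b}"])
    fix t assume t: "t \<in> {a..b}"
    show "(f has_derivative (\<lambda>h. h *\<^sub>R f' t)) (at t within {a..b})"
      using assms(2)[OF t] has_derivative_at_withinI unfolding has_vector_derivative_def by blast
    show "onorm (\<lambda>h. h *\<^sub>R f' t) \<le> K"
    proof (rule onorm_le)
      fix h :: real
      show "norm (h *\<^sub>R f' t) \<le> K * norm h"
        using mult_right_mono[OF assms(3)[OF t] abs_ge_zero[of h]] by (simp add: mult.commute)
    qed
  qed (use assms in auto)
  then show ?thesis using assms by simp
qed

lemma has_vector_derivative_along_line:
  assumes "(F has_derivative F') (at (a + s *\<^sub>R u))"
  shows "((\<lambda>s. F (a + s *\<^sub>R u)) has_vector_derivative F' u) (at s)"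
proof -
  have "((\<lambda>s. a + s *\<^sub>R u) has_derivative (\<lambda>h. h *\<^sub>R u)) (at s)"
    by (auto intro!: derivative_eq_intros)
  from has_derivative_compose[OF this assms] show ?thesis
    using linear_scale[OF has_derivative_linear[OF assms]]
    by (simp add: has_vector_derivative_def)
qed

text \<open>The mean value inequality, used once in the direction \<open>u\<close> and once in the direction \<open>v\<close>,
  compares the second difference over a small parallelogram with the mixed derivative at its
  corner.\<close>
lemma second_difference_estimate:
  fixes F :: "'p::real_normed_vector \<Rightarrow> 'q::real_normed_vector"
  assumes W: "open W" "p \<in> W"
    and F: "\<And>q. q \<in> W \<Longrightarrow> (F has_derivative F' q) (at q)"
    and Fu: "\<And>q. q \<in> W \<Longrightarrow> ((\<lambda>q. F' q u) has_derivative Fu q) (at q)"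
    and cont: "continuous_on W (\<lambda>q. Fu q v)"
    and "\<epsilon> > 0"
  shows "\<forall>\<^sub>F h in at_right 0.
    norm (F (p + h *\<^sub>R u + h *\<^sub>R v) - F (p + h *\<^sub>R u) - F (p + h *\<^sub>R v) + F p - (h * h) *\<^sub>R Fu p v) \<le> \<epsilon> * h * h"
proof -
  define c where "c = Fu p v"
  have "((\<lambda>q. Fu q v) \<longlongrightarrow> c) (at p)"
    using W cont continuous_on_eq_continuous_at isCont_def unfolding c_def by blast
  then have "\<forall>\<^sub>F q in at p. dist (Fu q v) c < \<epsilon>" using \<open>\<epsilon> > 0\<close> by (rule tendstoD)
  then have "\<forall>\<^sub>F q in nhds p. dist (Fu q v) c < \<epsilon>" unfolding eventually_at_filter
    by (rule eventually_mono) (use \<open>\<epsilon> > 0\<close> c_def in auto)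
  moreover have "\<forall>\<^sub>F q in nhds p. q \<in> W" using W by (simp add: eventually_nhds_in_open)
  ultimately have "\<forall>\<^sub>F q in nhds p. q \<in> W \<and> norm (Fu q v - c) < \<epsilon>"
    by eventually_elim (auto simp: dist_norm)
  then obtain r where r: "r > 0" "\<And>q. dist q p < r \<Longrightarrow> q \<in> W \<and> norm (Fu q v - c) < \<epsilon>"
    by (auto simp: eventually_nhds_metric)
  define d where "d = r / (norm u + norm v + 1)"
  have d: "d > 0" unfolding d_def using r by (intro divide_pos_pos add_nonneg_pos) auto
  have near: "q \<in> W \<and> norm (Fu q v - c) < \<epsilon>"
    if "q = p + s *\<^sub>R u + t *\<^sub>R v" "0 \<le> s" "s \<le> h" "0 \<le> t" "t \<le> h" "h < d" for q s t h
  proof (rule r(2))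
    have "dist q p = norm (s *\<^sub>R u + t *\<^sub>R v)" using that by (simp add: dist_norm)
    also have "\<dots> \<le> s * norm u + t * norm v" using norm_triangle_ineq[of "s *\<^sub>R u" "t *\<^sub>R v"] that by simp
    also have "\<dots> \<le> h * norm u + h * norm v" using that by (intro add_mono mult_right_mono) auto
    also have "\<dots> \<le> h * (norm u + norm v + 1)" using that by (simp add: algebra_simps)
    also have "\<dots> < d * (norm u + norm v + 1)" using that by (intro mult_strict_right_mono add_nonneg_pos) auto
    also have "\<dots> = r" unfolding d_def using norm_ge_zero[of u] norm_ge_zero[of v] by (simp add: add_nonneg_eq_0_iff)
    finally show "dist q p < r" .
  qed
  have main: "norm (F (p + h *\<^sub>R u + h *\<^sub>R v) - F (p + h *\<^sub>R u) - F (p + h *\<^sub>R v) + F p - (h * h) *\<^sub>R c) \<le> \<epsilon> * h * h"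
    if h: "0 < h" "h < d" for h
  proof -
    define G where "G s = F (p + s *\<^sub>R u + h *\<^sub>R v) - F (p + s *\<^sub>R u) - (s * h) *\<^sub>R c" for s
    define G' where "G' s = F' (p + s *\<^sub>R u + h *\<^sub>R v) u - F' (p + s *\<^sub>R u) u - h *\<^sub>R c" for s
    have "norm (G h - G 0) \<le> (\<epsilon> * h) * (h - 0)"
    proof (rule vector_mean_value_bound[where f' = G'])
      fix s assume s: "s \<in> {0..h}"
      have W1: "p + s *\<^sub>R u + h *\<^sub>R v \<in> W" using near[of _ s h h] s h by auto
      have W2: "p + s *\<^sub>R u \<in> W" using near[of "p + s *\<^sub>R u" s 0 h] s h by auto
      have 1: "((\<lambda>s. F (p + s *\<^sub>R u + h *\<^sub>R v)) has_vector_derivative F' (p + s *\<^sub>R u + h *\<^sub>R v) u) (at s)"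
        using has_vector_derivative_along_line[of F "F' (p + s *\<^sub>R u + h *\<^sub>R v)" "p + h *\<^sub>R v" s u] F[OF W1]
        by (simp add: add_ac)
      have 2: "((\<lambda>s. F (p + s *\<^sub>R u)) has_vector_derivative F' (p + s *\<^sub>R u) u) (at s)"
        by (rule has_vector_derivative_along_line[OF F[OF W2]])
      have 3: "((\<lambda>s. (s * h) *\<^sub>R c) has_vector_derivative h *\<^sub>R c) (at s)"
        unfolding has_vector_derivative_def
        by (auto intro!: derivative_eq_intros)
      show "(G has_vector_derivative G' s) (at s)"
        unfolding G_def G'_def by (intro has_vector_derivative_diff 1 2 3)
      define k where "k t = F' (p + s *\<^sub>R u + t *\<^sub>R v) u - t *\<^sub>R c" for t
      have "norm (k h - k 0) \<le> \<epsilon> * (h - 0)"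
      proof (rule vector_mean_value_bound[where f' = "\<lambda>t. Fu (p + s *\<^sub>R u + t *\<^sub>R v) v - c"])
        fix t assume t: "t \<in> {0..h}"
        have W3: "p + s *\<^sub>R u + t *\<^sub>R v \<in> W" and le: "norm (Fu (p + s *\<^sub>R u + t *\<^sub>R v) v - c) < \<epsilon>"
          using near[of _ s t h] s t h by auto
        have "((\<lambda>t. F' (p + s *\<^sub>R u + t *\<^sub>R v) u) has_vector_derivative Fu (p + s *\<^sub>R u + t *\<^sub>R v) v) (at t)"
          by (rule has_vector_derivative_along_line[OF Fu[OF W3]])
        then show "(k has_vector_derivative Fu (p + s *\<^sub>R u + t *\<^sub>R v) v - c) (at t)"
          unfolding k_def by (auto intro!: derivative_eq_intros)
        show "norm (Fu (p + s *\<^sub>R u + t *\<^sub>R v) v - c) \<le> \<epsilon>" using le by simp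
      qed (use h in auto)
      then show "norm (G' s) \<le> \<epsilon> * h" unfolding k_def G'_def by (simp add: algebra_simps)
    qed (use h in auto)
    then show ?thesis unfolding G_def by (simp add: algebra_simps)
  qed
  show ?thesis unfolding eventually_at_right_field using d main unfolding c_def by auto
qed

text \<open>Schwarz's theorem for maps between normed spaces: the second difference is symmetric in
  \<open>u\<close> and \<open>v\<close>, and both mixed derivatives approximate it.\<close>
lemma mixed_derivatives_symmetric:
  fixes F :: "'p::real_normed_vector \<Rightarrow> 'q::real_normed_vector"
  assumes W: "open W" "p \<in> W"
    and F: "\<And>q. q \<in> W \<Longrightarrow> (F has_derivative F' q) (at q)"
    and Fu: "\<And>q. q \<in> W \<Longrightarrow> ((\<lambda>q. F' q u) has_derivative Fu q) (at q)"
    and Fv: "\<And>q. q \<in> W \<Longrightarrow> ((\<lambda>q. F' q v) has_derivative Fv q) (at q)"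
    and contu: "continuous_on W (\<lambda>q. Fu q v)"
    and contv: "continuous_on W (\<lambda>q. Fv q u)"
  shows "Fu p v = Fv p u"
proof -
  have "norm (Fu p v - Fv p u) \<le> 0 + e" if "e > 0" for e
  proof -
    \<comment> \<open>Exchanging \<open>u\<close> and \<open>v\<close> leaves \<open>?D\<close> unchanged.\<close>
    let ?D = "\<lambda>h. F (p + h *\<^sub>R u + h *\<^sub>R v) - F (p + h *\<^sub>R u) - F (p + h *\<^sub>R v) + F p"
    have e2: "e / 2 > 0" using that by simp
    have "\<forall>\<^sub>F h in at_right 0. norm (?D h - (h * h) *\<^sub>R Fu p v) \<le> e / 2 * h * h"
      by (rule second_difference_estimate[OF W F Fu contu e2])
    moreover have "\<forall>\<^sub>F h in at_right 0. norm (?D h - (h * h) *\<^sub>R Fv p u) \<le> e / 2 * h * h"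
      using second_difference_estimate[OF W F Fv contv e2] by (simp add: algebra_simps)
    moreover have "\<forall>\<^sub>F h in at_right 0. (h::real) > 0" by (rule eventually_at_right_less)
    ultimately have "\<forall>\<^sub>F h in at_right (0::real). norm (Fu p v - Fv p u) \<le> 0 + e"
    proof eventually_elim
      case (elim h)
      have "(h * h) * norm (Fu p v - Fv p u) = norm ((?D h - (h * h) *\<^sub>R Fv p u) - (?D h - (h * h) *\<^sub>R Fu p v))"
        using elim by (simp add: norm_minus_commute flip: scaleR_diff_right)
      also have "\<dots> \<le> e / 2 * h * h + e / 2 * h * h"
        using elim norm_triangle_ineq4 by (smt (verit, best))
      also have "\<dots> = (h * h) * e" by simp
      finally show ?case using elim by simp
    qed
    then show ?thesis by simp
  qed
  then have "norm (Fu p v - Fv p u) \<le> 0" by (rule field_le_epsilon)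
  then show ?thesis by simp
qed

section \<open>Local existence for ordinary differential equations\<close>

lemma continuous_on_compose_lipschitz:
  fixes f :: "real \<Rightarrow> 'a::real_normed_vector \<Rightarrow> 'b::real_normed_vector"
  assumes lip: "\<And>t x y. t \<in> T \<Longrightarrow> x \<in> X \<Longrightarrow> y \<in> X \<Longrightarrow> norm (f t x - f t y) \<le> L * norm (x - y)"
    and cont: "\<And>x. x \<in> X \<Longrightarrow> continuous_on T (\<lambda>t. f t x)"
    and g: "continuous_on T g" "\<And>t. t \<in> T \<Longrightarrow> g t \<in> X"
  shows "continuous_on T (\<lambda>t. f t (g t))"
  unfolding continuous_on_def
proof
  fix s assume s: "s \<in> T"
  have 1: "((\<lambda>t. f t (g s)) \<longlongrightarrow> f s (g s)) (at s within T)"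
    using cont[OF g(2)[OF s]] s by (auto simp: continuous_on_def)
  have "((\<lambda>t. g t - g s) \<longlongrightarrow> 0) (at s within T)"
    using g(1) s by (simp add: continuous_on_def LIM_zero)
  then have "((\<lambda>t. L * norm (g t - g s)) \<longlongrightarrow> 0) (at s within T)"
    by (intro tendsto_mult_right_zero tendsto_norm_zero)
  moreover have "\<forall>\<^sub>F t in at s within T. norm (f t (g t) - f t (g s)) \<le> L * norm (g t - g s)"
    unfolding eventually_at_filter by (rule always_eventually) (simp add: lip g(2) s)
  ultimately have "((\<lambda>t. f t (g t) - f t (g s)) \<longlongrightarrow> 0) (at s within T)"
    by (rule Lim_null_comparison[rotated])
  from tendsto_add[OF this 1] show "((\<lambda>t. f t (g t)) \<longlongrightarrow> f s (g s)) (at s within T)"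
    by simp
qed

text \<open>A solution is a fixed point of the integral operator, a contraction because \<open>L (t\<^sub>1 - t\<^sub>0) < 1\<close>,
  on the closed set of bounded continuous curves in the ball.  These curves are defined on the
  whole line; \<open>proj\<close> retracts the line to \<open>[t\<^sub>0, t\<^sub>1]\<close> and extends the integrals constantly.\<close>
theorem picard_lindelof:
  fixes f :: "real \<Rightarrow> 'a::banach \<Rightarrow> 'a" and x\<^sub>0 :: 'a
  assumes t: "t\<^sub>0 \<le> t\<^sub>1" and r: "r \<ge> 0" and L: "L \<ge> 0"
    and lip: "\<And>t x y. t \<in> {t\<^sub>0..t\<^sub>1} \<Longrightarrow> x \<in> cball x\<^sub>0 r \<Longrightarrow> y \<in> cball x\<^sub>0 r \<Longrightarrow>
      norm (f t x - f t y) \<le> L * norm (x - y)"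
    and bound: "\<And>t x. t \<in> {t\<^sub>0..t\<^sub>1} \<Longrightarrow> x \<in> cball x\<^sub>0 r \<Longrightarrow> norm (f t x) \<le> M"
    and cont: "\<And>x. x \<in> cball x\<^sub>0 r \<Longrightarrow> continuous_on {t\<^sub>0..t\<^sub>1} (\<lambda>t. f t x)"
    and small: "M * (t\<^sub>1 - t\<^sub>0) \<le> r" "L * (t\<^sub>1 - t\<^sub>0) < 1"
  obtains x where "x t\<^sub>0 = x\<^sub>0" "\<And>t. t \<in> {t\<^sub>0..t\<^sub>1} \<Longrightarrow> x t \<in> cball x\<^sub>0 r"
    "\<And>t. t \<in> {t\<^sub>0..t\<^sub>1} \<Longrightarrow> (x has_vector_derivative f t (x t)) (at t within {t\<^sub>0..t\<^sub>1})"
proof -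
  define proj where "proj t = max t\<^sub>0 (min t\<^sub>1 t)" for t
  have proj: "proj t \<in> {t\<^sub>0..t\<^sub>1}" for t using t by (auto simp: proj_def)
  have proj_id: "proj t = t" if "t \<in> {t\<^sub>0..t\<^sub>1}" for t using that by (auto simp: proj_def)
  have proj_cont: "continuous_on UNIV proj" unfolding proj_def by (intro continuous_intros)
  define S where "S = PiC (UNIV :: real set) (\<lambda>_. cball x\<^sub>0 r)"
  have S: "apply_bcontfun g t \<in> cball x\<^sub>0 r" if "g \<in> S" for g t
    using mem_PiCD[of g UNIV "\<lambda>_. cball x\<^sub>0 r"] that unfolding S_def by (simp add: Pi_iff)
  define P where "P g = (\<lambda>t. x\<^sub>0 + integral {t\<^sub>0..proj t} (\<lambda>s. f s (apply_bcontfun g s)))" for g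
  have fg: "continuous_on {t\<^sub>0..t\<^sub>1} (\<lambda>s. f s (apply_bcontfun g s))" if "g \<in> S" for g
    by (rule continuous_on_compose_lipschitz[where X = "cball x\<^sub>0 r" and L = L])
      (use lip cont S[OF that] continuous_on_apply_bcontfun in auto)
  have fg': "continuous_on {t\<^sub>0..proj t} (\<lambda>s. f s (apply_bcontfun g s))" if "g \<in> S" for g t
    by (rule continuous_on_subset[OF fg[OF that]]) (use proj[of t] in auto)
  have P_ball: "P g t \<in> cball x\<^sub>0 r" if "g \<in> S" for g t
  proof -
    have "norm (integral {t\<^sub>0..proj t} (\<lambda>s. f s (apply_bcontfun g s))) \<le> M * (proj t - t\<^sub>0)"
      by (rule integral_bound[OF _ fg'[OF that]]) (use proj[of t] bound[OF _ S[OF that]] in auto)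
    also have "\<dots> \<le> M * (t\<^sub>1 - t\<^sub>0)"
    proof (rule mult_left_mono)
      show "0 \<le> M" using order_trans[OF norm_ge_zero bound[of t\<^sub>0 x\<^sub>0]] t r by simp
    qed (use proj[of t] in auto)
    also have "\<dots> \<le> r" by (rule small)
    finally show ?thesis unfolding P_def by (simp add: dist_norm)
  qed
  have P_cont: "continuous_on UNIV (P g)" if "g \<in> S" for g
  proof -
    have "continuous_on {t\<^sub>0..t\<^sub>1} (\<lambda>u. integral {t\<^sub>0..u} (\<lambda>s. f s (apply_bcontfun g s)))"
      by (rule indefinite_integral_continuous_1 integrable_continuous_real fg that)+
    moreover have "range proj \<subseteq> {t\<^sub>0..t\<^sub>1}" using proj by blast
    ultimately have "continuous_on UNIV (\<lambda>t. integral {t\<^sub>0..proj t} (\<lambda>s. f s (apply_bcontfun g s)))"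
      by (rule continuous_on_compose2[OF _ proj_cont])
    then show ?thesis unfolding P_def by (intro continuous_intros)
  qed
  have P_bcont: "P g \<in> bcontfun" if "g \<in> S" for g
  proof -
    have "range (P g) \<subseteq> cball x\<^sub>0 r" using P_ball[OF that] by blast
    then show ?thesis
      unfolding bcontfun_def using P_cont[OF that] bounded_subset[OF bounded_cball] by simp
  qed
  define Q where "Q g = Bcontfun (P g)" for g
  have Q: "apply_bcontfun (Q g) = P g" if "g \<in> S" for g
    unfolding Q_def using P_bcont[OF that] by (simp add: Bcontfun_inverse)
  have "\<exists>!g\<in>S. Q g = g"
  proof (rule Banach_fix[of S "L * (t\<^sub>1 - t\<^sub>0)"])
    show "complete S" unfolding S_def complete_eq_closed by (intro closed_PiC) auto
    have "const_bcontfun x\<^sub>0 \<in> S" unfolding S_def using r by (intro mem_PiCI) (simp add: const_bcontfun.rep_eq)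
    then show "S \<noteq> {}" by auto
    show "0 \<le> L * (t\<^sub>1 - t\<^sub>0)" using L t by simp
    show "L * (t\<^sub>1 - t\<^sub>0) < 1" by (rule small)
    show "Q ` S \<subseteq> S"
    proof
      fix h assume "h \<in> Q ` S"
      then obtain g where "g \<in> S" "h = Q g" by blast
      then show "h \<in> S" using P_ball[of g] Q[of g] unfolding S_def by (intro mem_PiCI) (simp add: Pi_iff)
    qed
    fix g h assume gh: "g \<in> S" "h \<in> S"
    show "dist (Q g) (Q h) \<le> L * (t\<^sub>1 - t\<^sub>0) * dist g h"
    proof (rule dist_bound)
      fix t
      let ?d = "\<lambda>s. f s (apply_bcontfun g s) - f s (apply_bcontfun h s)"
      have "P g t - P h t = integral {t\<^sub>0..proj t} ?d"
        unfolding P_def using fg'[OF gh(1)] fg'[OF gh(2)]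
        by (simp add: integral_diff integrable_continuous_real)
      also have "norm \<dots> \<le> (L * dist g h) * (proj t - t\<^sub>0)"
      proof (rule integral_bound)
        show "t\<^sub>0 \<le> proj t" using proj[of t] by simp
        show "continuous_on {t\<^sub>0..proj t} ?d"
          by (intro continuous_on_diff fg' gh)
        fix s assume "s \<in> {t\<^sub>0..proj t}"
        then have "s \<in> {t\<^sub>0..t\<^sub>1}" using proj[of t] by simp
        then have "norm (?d s) \<le> L * norm (apply_bcontfun g s - apply_bcontfun h s)"
          by (rule lip[OF _ S[OF gh(1)] S[OF gh(2)]])
        also have "\<dots> \<le> L * dist g h"
          using mult_left_mono[OF dist_bounded[of g s h] L] by (simp add: dist_norm)
        finally show "norm (?d s) \<le> L * dist g h" .
      qed
      also have "\<dots> \<le> (L * dist g h) * (t\<^sub>1 - t\<^sub>0)"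
        using proj[of t] L by (intro mult_left_mono) auto
      finally show "dist (apply_bcontfun (Q g) t) (apply_bcontfun (Q h) t) \<le> L * (t\<^sub>1 - t\<^sub>0) * dist g h"
        using Q gh by (simp add: dist_norm mult_ac)
    qed
  qed
  then obtain g where g: "g \<in> S" "Q g = g" by blast
  let ?x = "apply_bcontfun g"
  have x: "?x t = x\<^sub>0 + integral {t\<^sub>0..proj t} (\<lambda>s. f s (?x s))" for t
  proof -
    have "apply_bcontfun (Q g) t = P g t" using Q[OF g(1)] by simp
    then show ?thesis unfolding g(2) P_def .
  qed
  have x': "?x t = x\<^sub>0 + integral {t\<^sub>0..t} (\<lambda>s. f s (?x s))" if "t \<in> {t\<^sub>0..t\<^sub>1}" for t
    using x[of t] unfolding proj_id[OF that] .
  show thesis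
  proof (rule that[of ?x])
    show "?x t\<^sub>0 = x\<^sub>0" using x'[of t\<^sub>0] t by simp
    fix s assume s: "s \<in> {t\<^sub>0..t\<^sub>1}"
    show "?x s \<in> cball x\<^sub>0 r" by (rule S[OF g(1)])
    have "((\<lambda>u. x\<^sub>0 + integral {t\<^sub>0..u} (\<lambda>s. f s (?x s))) has_vector_derivative f s (?x s)) (at s within {t\<^sub>0..t\<^sub>1})"
      using has_vector_derivative_add[OF has_vector_derivative_const[of x\<^sub>0]
          integral_has_vector_derivative[OF fg[OF g(1)] s]] by simp
    then show "(?x has_vector_derivative f s (?x s)) (at s within {t\<^sub>0..t\<^sub>1})"
      by (rule has_vector_derivative_transform[OF s x', rotated])
  qed
qed

section \<open>Charts and coordinate representations\<close>

abbreviation coord_rep ::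
    "('m, 'e::real_normed_vector) chart \<Rightarrow> ('n, 'f::real_normed_vector) chart \<Rightarrow> ('m \<Rightarrow> 'n) \<Rightarrow> 'e \<Rightarrow> 'f" where
  "coord_rep c d h \<equiv> snd d \<circ> h \<circ> inv_into (fst c) (snd c)"

lemma has_derivative_transform_nhds:
  assumes "(f has_derivative D) (at x)" "\<forall>\<^sub>F y in nhds x. f y = g y"
  shows "(g has_derivative D) (at x)"
proof (rule has_derivative_transform_eventually[OF assms(1)])
  show "\<forall>\<^sub>F y in at x. f y = g y"
    using assms(2) unfolding eventually_at_filter by eventually_elim simp
  show "f x = g x" using assms(2) by (rule eventually_nhds_x_imp_x)
qed simp

context lie_group
begin

lemma chart_facts:
  assumes "c \<in> A"
  shows chart_openin: "openin T (fst c)"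
    and open_chart_image: "open (snd c ` fst c)"
    and inj_on_chart: "inj_on (snd c) (fst c)"
    and chart_subset_carrier: "fst c \<subseteq> carrier G"
    and chart_inverse_continuous: "continuous_map (top_of_set (snd c ` fst c)) T (inv_into (fst c) (snd c))"
proof -
  obtain U \<phi> where c: "c = (U, \<phi>)" by (cases c)
  have "is_chart T c" using smooth_structure assms unfolding smooth_structure_def by blast
  then have *: "openin T U" "open (\<phi> ` U)" "homeomorphic_map (subtopology T U) (top_of_set (\<phi> ` U)) \<phi>"
    unfolding is_chart_def c by auto
  show "openin T (fst c)" "open (snd c ` fst c)" using * c by auto
  have sub: "U \<subseteq> topspace T" using *(1) by (rule openin_subset)
  then have top: "topspace (subtopology T U) = U" by auto
  show "fst c \<subseteq> carrier G" using sub topspace_eq c by simp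
  have inj: "inj_on \<phi> U" using homeomorphic_imp_injective_map[OF *(3)] top by simp
  then show "inj_on (snd c) (fst c)" using c by simp
  obtain g where g: "homeomorphic_maps (subtopology T U) (top_of_set (\<phi> ` U)) \<phi> g"
    using *(3) homeomorphic_map_maps by blast
  have "continuous_map (top_of_set (\<phi> ` U)) T g"
    using g unfolding homeomorphic_maps_def by (simp add: continuous_map_in_subtopology)
  moreover have "g y = inv_into U \<phi> y" if y: "y \<in> topspace (top_of_set (\<phi> ` U))" for y
  proof -
    obtain x where x: "x \<in> U" "y = \<phi> x" using y by auto
    have "g (\<phi> x) = x" using g x top unfolding homeomorphic_maps_def by simp
    then show ?thesis using x inj by simp
  qed
  ultimately have "continuous_map (top_of_set (\<phi> ` U)) T (inv_into U \<phi>)"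
    by (rule continuous_map_eq)
  then show "continuous_map (top_of_set (snd c ` fst c)) T (inv_into (fst c) (snd c))"
    using c by simp
qed

lemma chart_around:
  assumes "x \<in> carrier G"
  obtains d where "d \<in> A" "x \<in> fst d"
proof -
  have "(\<Union>(U, \<phi>)\<in>A. U) = carrier G"
    using smooth_structure topspace_eq unfolding smooth_structure_def by simp
  with assms have "x \<in> (\<Union>(U, \<phi>)\<in>A. U)" by simp
  then obtain U \<phi> where "(U, \<phi>) \<in> A" "x \<in> U" by auto
  then show thesis using that[of "(U, \<phi>)"] by simp
qed

lemma chart_inverse:
  assumes "c \<in> A" "x \<in> fst c"
  shows "inv_into (fst c) (snd c) (snd c x) = x"
  using inj_on_chart assms by simp

text \<open>Coordinate representations are meaningful only where the image point lies in the target
  chart.  For continuous maps this is the case near the base point, which is all that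
  derivatives see.\<close>
lemma eventually_in_chart:
  assumes c: "c \<in> A" "x \<in> fst c" and d: "d \<in> A" "q x \<in> fst d" and q: "continuous_map T T q"
  shows "\<forall>\<^sub>F a in nhds (snd c x). inv_into (fst c) (snd c) a \<in> fst c \<and> q (inv_into (fst c) (snd c) a) \<in> fst d"
proof -
  let ?V = "snd c ` fst c" and ?\<iota> = "inv_into (fst c) (snd c)"
  have "continuous_map (top_of_set ?V) T (q \<circ> ?\<iota>)"
    using chart_inverse_continuous[OF c(1)] q by (rule continuous_map_compose)
  from openin_continuous_map_preimage[OF this chart_openin[OF d(1)]]
  have "openin (top_of_set ?V) {a \<in> ?V. q (?\<iota> a) \<in> fst d}" by simp
  then have "open {a \<in> ?V. q (?\<iota> a) \<in> fst d}"
    using openin_open_eq[OF open_chart_image[OF c(1)]] by blast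
  moreover have "snd c x \<in> {a \<in> ?V. q (?\<iota> a) \<in> fst d}"
    using c d chart_inverse by simp
  ultimately have "\<forall>\<^sub>F a in nhds (snd c x). a \<in> {a \<in> ?V. q (?\<iota> a) \<in> fst d}"
    by (rule eventually_nhds_in_open)
  then show ?thesis by eventually_elim (auto intro: inv_into_into)
qed

text \<open>The chain rule across charts.  The composite is allowed to differ from \<open>r\<close> outside the domain of
  the first chart, since group identities hold only for elements of the carrier.\<close>
lemma coord_rep_compose:
  assumes c: "c \<in> A" "x \<in> fst c" and d: "d \<in> A" "q x \<in> fst d" and q: "continuous_map T T q"
    and Q: "(coord_rep c d q has_derivative Q) (at (snd c x))"
    and P: "(coord_rep d e p has_derivative P) (at (snd d (q x)))"
    and r: "\<And>h. h \<in> fst c \<Longrightarrow> r h = p (q h)"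
  shows "(coord_rep c e r has_derivative (\<lambda>v. P (Q v))) (at (snd c x))"
proof -
  have "coord_rep c d q (snd c x) = snd d (q x)" using chart_inverse c by simp
  then have "(coord_rep d e p has_derivative P) (at (coord_rep c d q (snd c x)))"
    using P by (simp only:)
  from has_derivative_compose[OF Q this]
  have "((\<lambda>a. coord_rep d e p (coord_rep c d q a)) has_derivative (\<lambda>v. P (Q v))) (at (snd c x))" .
  moreover have "\<forall>\<^sub>F a in nhds (snd c x). coord_rep d e p (coord_rep c d q a) = coord_rep c e r a"
    using eventually_in_chart[OF c d q] by eventually_elim (simp add: r chart_inverse[OF d(1)])
  ultimately show ?thesis
    by (rule has_derivative_transform_nhds)
qed

lemma coord_rep_identity:
  assumes c: "c \<in> A" "x \<in> fst c" and r: "\<And>h. h \<in> fst c \<Longrightarrow> r h = h"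
  shows "(coord_rep c c r has_derivative (\<lambda>v. v)) (at (snd c x))"
proof (rule has_derivative_transform_within_open)
  show "open (snd c ` fst c)" by (rule open_chart_image[OF c(1)])
  show "snd c x \<in> snd c ` fst c" using c by simp
  show "((\<lambda>a. a) has_derivative (\<lambda>v. v)) (at (snd c x))" by simp
  show "a = coord_rep c c r a" if "a \<in> snd c ` fst c" for a
    using that r by (simp add: inv_into_into f_inv_into_f)
qed

lemma right_translation_continuous:
  assumes "k \<in> carrier G" shows "continuous_map T T (\<lambda>h. h \<otimes> k)"
proof -
  have "continuous_map T (prod_topology T T) (\<lambda>h. (h, k))"
    using assms topspace_eq by (simp add: continuous_map_pairedI)
  moreover have "continuous_map (prod_topology T T) T (\<lambda>(x, y). x \<otimes> y)"
    using smooth_mult unfolding smooth_map_def by blast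
  ultimately show ?thesis
    using continuous_map_compose[of T "prod_topology T T" "\<lambda>h. (h, k)" T "\<lambda>(x, y). x \<otimes> y"]
    by (simp add: o_def)
qed

lemma left_translation_continuous:
  assumes "k \<in> carrier G" shows "continuous_map T T (\<lambda>h. k \<otimes> h)"
proof -
  have "continuous_map T (prod_topology T T) (\<lambda>h. (k, h))"
    using assms topspace_eq by (simp add: continuous_map_pairedI)
  moreover have "continuous_map (prod_topology T T) T (\<lambda>(x, y). x \<otimes> y)"
    using smooth_mult unfolding smooth_map_def by blast
  ultimately show ?thesis
    using continuous_map_compose[of T "prod_topology T T" "\<lambda>h. (k, h)" T "\<lambda>(x, y). x \<otimes> y"]
    by (simp add: o_def)
qed

text \<open>The map and the set for which smoothness of the multiplication, stated with the product atlas,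
  asserts that the one is smooth on the other.\<close>
definition mult_rep ::
    "('g, 'e) chart \<Rightarrow> ('g, 'e) chart \<Rightarrow> ('g, 'e) chart \<Rightarrow> 'e \<times> 'e \<Rightarrow> 'e" where
  "mult_rep c\<^sub>1 c\<^sub>2 d = snd d \<circ> (\<lambda>(x, y). x \<otimes> y) \<circ> inv_into (fst c\<^sub>1 \<times> fst c\<^sub>2) (map_prod (snd c\<^sub>1) (snd c\<^sub>2))"

definition mult_dom ::
    "('g, 'e) chart \<Rightarrow> ('g, 'e) chart \<Rightarrow> ('g, 'e) chart \<Rightarrow> ('e \<times> 'e) set" where
  "mult_dom c\<^sub>1 c\<^sub>2 d = map_prod (snd c\<^sub>1) (snd c\<^sub>2) ` {p \<in> fst c\<^sub>1 \<times> fst c\<^sub>2. (case p of (x, y) \<Rightarrow> x \<otimes> y) \<in> fst d}"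

lemma smooth_mult_rep:
  assumes "c\<^sub>1 \<in> A" "c\<^sub>2 \<in> A" "d \<in> A"
  shows "smooth_on (mult_dom c\<^sub>1 c\<^sub>2 d) (mult_rep c\<^sub>1 c\<^sub>2 d)"
proof -
  obtain U\<^sub>1 \<phi>\<^sub>1 U\<^sub>2 \<phi>\<^sub>2 V \<psi> where eq: "c\<^sub>1 = (U\<^sub>1, \<phi>\<^sub>1)" "c\<^sub>2 = (U\<^sub>2, \<phi>\<^sub>2)" "d = (V, \<psi>)"
    by (metis surj_pair)
  have "(U\<^sub>1 \<times> U\<^sub>2, map_prod \<phi>\<^sub>1 \<phi>\<^sub>2) \<in> product_atlas A A"
    unfolding product_atlas_def using assms eq by auto
  moreover have "\<forall>(U, \<phi>)\<in>product_atlas A A. \<forall>(V, \<psi>)\<in>A.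
      smooth_on (\<phi> ` {p \<in> U. (case p of (x, y) \<Rightarrow> x \<otimes> y) \<in> V}) (\<psi> \<circ> (\<lambda>(x, y). x \<otimes> y) \<circ> inv_into U \<phi>)"
    using smooth_mult unfolding smooth_map_def by blast
  moreover have "(V, \<psi>) \<in> A" using assms eq by simp
  ultimately have "smooth_on (map_prod \<phi>\<^sub>1 \<phi>\<^sub>2 ` {p \<in> U\<^sub>1 \<times> U\<^sub>2. (case p of (x, y) \<Rightarrow> x \<otimes> y) \<in> V})
      (\<psi> \<circ> (\<lambda>(x, y). x \<otimes> y) \<circ> inv_into (U\<^sub>1 \<times> U\<^sub>2) (map_prod \<phi>\<^sub>1 \<phi>\<^sub>2))"
    by fastforce
  then show ?thesis unfolding mult_rep_def mult_dom_def eq by simp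
qed

lemma mult_rep_apply:
  assumes "c\<^sub>1 \<in> A" "c\<^sub>2 \<in> A" "x \<in> fst c\<^sub>1" "y \<in> fst c\<^sub>2"
  shows "mult_rep c\<^sub>1 c\<^sub>2 d (snd c\<^sub>1 x, snd c\<^sub>2 y) = snd d (x \<otimes> y)"
proof -
  have "inj_on (map_prod (snd c\<^sub>1) (snd c\<^sub>2)) (fst c\<^sub>1 \<times> fst c\<^sub>2)"
    using assms inj_on_chart by (intro map_prod_inj_on) auto
  from inv_into_f_f[OF this, of "(x, y)"] show ?thesis
    using assms by (simp add: mult_rep_def)
qed

lemma mult_dom_memI:
  assumes "x \<in> fst c\<^sub>1" "y \<in> fst c\<^sub>2" "x \<otimes> y \<in> fst d"
  shows "(snd c\<^sub>1 x, snd c\<^sub>2 y) \<in> mult_dom c\<^sub>1 c\<^sub>2 d"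
  unfolding mult_dom_def using assms by (intro image_eqI[of _ _ "(x, y)"]) auto

lemma mult_rep_differentiable:
  assumes "c\<^sub>1 \<in> A" "c\<^sub>2 \<in> A" "d \<in> A" "q \<in> mult_dom c\<^sub>1 c\<^sub>2 d"
  shows "mult_rep c\<^sub>1 c\<^sub>2 d differentiable (at q)"
proof -
  have "Ck_on (Suc 0) (mult_dom c\<^sub>1 c\<^sub>2 d) (mult_rep c\<^sub>1 c\<^sub>2 d)"
    using smooth_mult_rep[OF assms(1-3)] unfolding smooth_on_def by blast
  then show ?thesis using assms(4) by simp
qed

lemma right_translation_coord_rep:
  assumes c: "c \<in> A" "x \<in> fst c" and e: "e \<in> A" "k \<in> fst e" and d: "d \<in> A" "x \<otimes> k \<in> fst d"
    and D: "(mult_rep c e d has_derivative D) (at (snd c x, snd e k))"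
  shows "(coord_rep c d (\<lambda>h. h \<otimes> k) has_derivative (\<lambda>v. D (v, 0))) (at (snd c x))"
proof (rule has_derivative_transform_within_open)
  show "open (snd c ` fst c)" by (rule open_chart_image[OF c(1)])
  show "snd c x \<in> snd c ` fst c" using c by simp
  have "((\<lambda>a. (a, snd e k)) has_derivative (\<lambda>v. (v, 0))) (at (snd c x))"
    by (auto intro!: derivative_eq_intros)
  from has_derivative_compose[OF this D]
  show "((\<lambda>a. mult_rep c e d (a, snd e k)) has_derivative (\<lambda>v. D (v, 0))) (at (snd c x))" .
  show "mult_rep c e d (a, snd e k) = coord_rep c d (\<lambda>h. h \<otimes> k) a" if a: "a \<in> snd c ` fst c" for a
  proof -
    obtain y where "y \<in> fst c" "a = snd c y" using a by blast
    then show ?thesis using mult_rep_apply[OF c(1) e(1) _ e(2)] chart_inverse[OF c(1)] by simp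
  qed
qed

lemma left_translation_coord_rep:
  assumes c: "c \<in> A" "x \<in> fst c" and e: "e \<in> A" "k \<in> fst e" and d: "d \<in> A" "k \<otimes> x \<in> fst d"
    and D: "(mult_rep e c d has_derivative D) (at (snd e k, snd c x))"
  shows "(coord_rep c d (\<lambda>h. k \<otimes> h) has_derivative (\<lambda>v. D (0, v))) (at (snd c x))"
proof (rule has_derivative_transform_within_open)
  show "open (snd c ` fst c)" by (rule open_chart_image[OF c(1)])
  show "snd c x \<in> snd c ` fst c" using c by simp
  have "((\<lambda>a. (snd e k, a)) has_derivative (\<lambda>v. (0, v))) (at (snd c x))"
    by (auto intro!: derivative_eq_intros)
  from has_derivative_compose[OF this D]
  show "((\<lambda>a. mult_rep e c d (snd e k, a)) has_derivative (\<lambda>v. D (0, v))) (at (snd c x))" .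
  show "mult_rep e c d (snd e k, a) = coord_rep c d (\<lambda>h. k \<otimes> h) a" if a: "a \<in> snd c ` fst c" for a
  proof -
    obtain y where "y \<in> fst c" "a = snd c y" using a by blast
    then show ?thesis using mult_rep_apply[OF e(1) c(1) e(2)] chart_inverse[OF c(1)] by simp
  qed
qed

lemma right_translation_differentiable:
  assumes c: "c \<in> A" "x \<in> fst c" and k: "k \<in> carrier G" and d: "d \<in> A" "x \<otimes> k \<in> fst d"
  shows "coord_rep c d (\<lambda>h. h \<otimes> k) differentiable (at (snd c x))"
proof -
  obtain e where e: "e \<in> A" "k \<in> fst e" using chart_around[OF k] .
  obtain D where "(mult_rep c e d has_derivative D) (at (snd c x, snd e k))"
    using mult_rep_differentiable[OF c(1) e(1) d(1) mult_dom_memI[OF c(2) e(2) d(2)]]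
    unfolding differentiable_def by blast
  from right_translation_coord_rep[OF c e d this] show ?thesis
    unfolding differentiable_def by blast
qed

lemma left_translation_differentiable:
  assumes c: "c \<in> A" "x \<in> fst c" and k: "k \<in> carrier G" and d: "d \<in> A" "k \<otimes> x \<in> fst d"
  shows "coord_rep c d (\<lambda>h. k \<otimes> h) differentiable (at (snd c x))"
proof -
  obtain e where e: "e \<in> A" "k \<in> fst e" using chart_around[OF k] .
  obtain D where "(mult_rep e c d has_derivative D) (at (snd e k, snd c x))"
    using mult_rep_differentiable[OF e(1) c(1) d(1) mult_dom_memI[OF e(2) c(2) d(2)]]
    unfolding differentiable_def by blast
  from left_translation_coord_rep[OF c e d this] show ?thesis
    unfolding differentiable_def by blast
qed

end

section \<open>The adjoint action\<close>

text \<open>A chart around the identity is fixed; it serves as coordinates both for the Lie algebra and for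
  the group near the identity.\<close>
locale lie_group_chart = lie_group G T A
  for G :: "('g, 'x) monoid_scheme" (structure)
    and T :: "'g topology"
    and A :: "('g, 'e::banach) chart set" +
  fixes c :: "('g, 'e) chart"
  assumes chart: "c \<in> A" and one_in_chart: "\<one> \<in> fst c"
begin

abbreviation "U \<equiv> fst c"
abbreviation "V \<equiv> snd c ` fst c"
abbreviation "\<phi> \<equiv> snd c"
abbreviation "\<iota> \<equiv> inv_into (fst c) (snd c)"
abbreviation "\<epsilon> \<equiv> snd c \<one>"

lemma U_carrier: "x \<in> U \<Longrightarrow> x \<in> carrier G"
  using chart_subset_carrier[OF chart] by blast

lemma iota_in [simp]: "a \<in> V \<Longrightarrow> \<iota> a \<in> U"
  by (rule inv_into_into)

lemma iota_carrier [simp]: "a \<in> V \<Longrightarrow> \<iota> a \<in> carrier G"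
  using U_carrier iota_in by blast

lemma phi_iota [simp]: "a \<in> V \<Longrightarrow> \<phi> (\<iota> a) = a"
  by (rule f_inv_into_f)

lemma iota_phi [simp]: "x \<in> U \<Longrightarrow> \<iota> (\<phi> x) = x"
  by (rule chart_inverse[OF chart])

lemma open_V: "open V"
  by (rule open_chart_image[OF chart])

lemma identity_in_V [simp]: "\<epsilon> \<in> V"
  using one_in_chart by simp

lemma conjugation_continuous:
  assumes "g \<in> carrier G" shows "continuous_map T T (\<lambda>h. g \<otimes> h \<otimes> inv g)"
  using continuous_map_compose[OF left_translation_continuous[OF assms]
      right_translation_continuous[of "inv g"]] assms by (simp add: o_def)

text \<open>Conjugation fixes \<open>\<one>\<close> but is a product of two translations with intermediate value \<open>g\<close>, which
  may lie far from the fixed chart; hence the detour through a chart around \<open>g\<close>.\<close>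
lemma Ad_has_derivative:
  assumes g: "g \<in> carrier G"
  shows "(coord_rep c c (\<lambda>h. g \<otimes> h \<otimes> inv g) has_derivative Ad G c g) (at \<epsilon>)"
proof -
  obtain d where d: "d \<in> A" "g \<in> fst d" using chart_around[OF g] .
  have "coord_rep c d (\<lambda>h. g \<otimes> h) differentiable (at \<epsilon>)"
    by (rule left_translation_differentiable[OF chart one_in_chart g d(1)]) (use d g in simp)
  then obtain Q where Q: "(coord_rep c d (\<lambda>h. g \<otimes> h) has_derivative Q) (at \<epsilon>)"
    unfolding differentiable_def by blast
  have "coord_rep d c (\<lambda>h. h \<otimes> inv g) differentiable (at (snd d g))"
    by (rule right_translation_differentiable[OF d _ chart]) (use one_in_chart g in simp_all)
  then obtain P where P: "(coord_rep d c (\<lambda>h. h \<otimes> inv g) has_derivative P) (at (snd d (g \<otimes> \<one>)))"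
    using g unfolding differentiable_def by auto
  have "(coord_rep c c (\<lambda>h. g \<otimes> h \<otimes> inv g) has_derivative (\<lambda>v. P (Q v))) (at \<epsilon>)"
    by (rule coord_rep_compose[OF chart one_in_chart d(1) _ left_translation_continuous[OF g] Q P])
      (use d g in simp_all)
  moreover from this have "(\<lambda>v. P (Q v)) = Ad G c g"
    unfolding Ad_def tangent_map_def by (rule frechet_derivative_at)
  ultimately show ?thesis by simp
qed

lemma Ad_unique:
  assumes "g \<in> carrier G" "(coord_rep c c (\<lambda>h. g \<otimes> h \<otimes> inv g) has_derivative D) (at \<epsilon>)"
  shows "Ad G c g = D"
  using has_derivative_unique[OF Ad_has_derivative[OF assms(1)] assms(2)] .

lemma Ad_one: "Ad G c \<one> v = v"
proof -
  have "(coord_rep c c (\<lambda>h. \<one> \<otimes> h \<otimes> inv \<one>) has_derivative (\<lambda>v. v)) (at \<epsilon>)"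
    by (rule coord_rep_identity[OF chart one_in_chart]) (use U_carrier in simp)
  from Ad_unique[OF one_closed this] show ?thesis by simp
qed

lemma Ad_mult:
  assumes g: "g \<in> carrier G" and k: "k \<in> carrier G"
  shows "Ad G c (g \<otimes> k) v = Ad G c g (Ad G c k v)"
proof -
  have k1: "k \<otimes> \<one> \<otimes> inv k = \<one>" using k by simp
  have P: "(coord_rep c c (\<lambda>h. g \<otimes> h \<otimes> inv g) has_derivative Ad G c g) (at (\<phi> (k \<otimes> \<one> \<otimes> inv k)))"
    using Ad_has_derivative[OF g] k1 by simp
  have "(coord_rep c c (\<lambda>h. (g \<otimes> k) \<otimes> h \<otimes> inv (g \<otimes> k)) has_derivative (\<lambda>v. Ad G c g (Ad G c k v))) (at \<epsilon>)"
    by (rule coord_rep_compose[OF chart one_in_chart chart _ conjugation_continuous[OF k] Ad_has_derivative[OF k] P])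
      (use k1 one_in_chart g k U_carrier in \<open>simp_all add: inv_mult_group m_assoc\<close>)
  from Ad_unique[OF _ this] g k show ?thesis by simp
qed

section \<open>Invariant vector fields near the identity\<close>

abbreviation "m \<equiv> mult_rep c c c"
abbreviation "W \<equiv> mult_dom c c c"

text \<open>First and second derivative of the local multiplication.  \<open>D2m u q v\<close> is the derivative at
  \<open>q\<close> in the direction \<open>v\<close> of the derivative in the direction \<open>u\<close>.\<close>
definition Dm :: "'e \<times> 'e \<Rightarrow> 'e \<times> 'e \<Rightarrow> 'e" where
  "Dm q u = frechet_derivative m (at q) u"

definition D2m :: "'e \<times> 'e \<Rightarrow> 'e \<times> 'e \<Rightarrow> 'e \<times> 'e \<Rightarrow> 'e" where
  "D2m u q v = frechet_derivative (\<lambda>q. Dm q u) (at q) v"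

definition right_invariant_field :: "'e \<Rightarrow> 'e \<Rightarrow> 'e" where
  "right_invariant_field v a = tangent_map c c (\<lambda>h. h \<otimes> \<iota> a) \<one> v"

abbreviation "R \<equiv> right_invariant_field"
abbreviation "L \<equiv> left_invariant_field G c"

lemma W_iff: "(a, b) \<in> W \<longleftrightarrow> a \<in> V \<and> b \<in> V \<and> \<iota> a \<otimes> \<iota> b \<in> U"
proof
  assume "(a, b) \<in> W"
  then obtain x y where "x \<in> U" "y \<in> U" "x \<otimes> y \<in> U" "a = \<phi> x" "b = \<phi> y"
    unfolding mult_dom_def by auto
  then show "a \<in> V \<and> b \<in> V \<and> \<iota> a \<otimes> \<iota> b \<in> U" by simp
next
  assume "a \<in> V \<and> b \<in> V \<and> \<iota> a \<otimes> \<iota> b \<in> U"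
  then show "(a, b) \<in> W" using mult_dom_memI[of "\<iota> a" c "\<iota> b" c c] by simp
qed

lemma axis_in_W: "a \<in> V \<Longrightarrow> (a, \<epsilon>) \<in> W" "a \<in> V \<Longrightarrow> (\<epsilon>, a) \<in> W"
  by (simp_all add: W_iff one_in_chart)

lemma open_W: "open W"
proof -
  have 1: "continuous_map (top_of_set (V \<times> V)) T (\<lambda>p. \<iota> (fst p))"
  proof -
    have "continuous_map (top_of_set (V \<times> V)) (top_of_set V) fst"
      by (auto intro!: continuous_intros)
    from continuous_map_compose[OF this chart_inverse_continuous[OF chart]]
    show ?thesis by (simp add: o_def)
  qed
  have 2: "continuous_map (top_of_set (V \<times> V)) T (\<lambda>p. \<iota> (snd p))"
  proof -
    have "continuous_map (top_of_set (V \<times> V)) (top_of_set V) snd"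
      by (auto intro!: continuous_intros)
    from continuous_map_compose[OF this chart_inverse_continuous[OF chart]]
    show ?thesis by (simp add: o_def)
  qed
  have "continuous_map (prod_topology T T) T (\<lambda>(x, y). x \<otimes> y)"
    using smooth_mult unfolding smooth_map_def by blast
  from continuous_map_compose[OF continuous_map_pairedI[OF 1 2] this]
  have "continuous_map (top_of_set (V \<times> V)) T (\<lambda>p. \<iota> (fst p) \<otimes> \<iota> (snd p))"
    by (simp add: o_def)
  from openin_continuous_map_preimage[OF this chart_openin[OF chart]]
  have "openin (top_of_set (V \<times> V)) {p \<in> V \<times> V. \<iota> (fst p) \<otimes> \<iota> (snd p) \<in> U}" by simp
  then have "open {p \<in> V \<times> V. \<iota> (fst p) \<otimes> \<iota> (snd p) \<in> U}"
    using openin_open_eq[OF open_Times[OF open_V open_V]] by blast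
  moreover have "W = {p \<in> V \<times> V. \<iota> (fst p) \<otimes> \<iota> (snd p) \<in> U}"
    using W_iff by auto
  ultimately show ?thesis by simp
qed

lemma Dm_has_derivative: "q \<in> W \<Longrightarrow> (m has_derivative Dm q) (at q)"
  using mult_rep_differentiable[OF chart chart chart]
  unfolding Dm_def by (simp add: frechet_derivative_works)

lemma D2m_facts:
  shows D2m_has_derivative: "q \<in> W \<Longrightarrow> ((\<lambda>q. Dm q u) has_derivative D2m u q) (at q)"
    and D2m_continuous: "continuous_on W (\<lambda>q. D2m u q v)"
proof -
  have "Ck_on (Suc (Suc 0)) W m"
    using smooth_mult_rep[OF chart chart chart] unfolding smooth_on_def by blast
  then have "Ck_on (Suc 0) W (\<lambda>q. Dm q u)" unfolding Dm_def Ck_on.simps(2)[of "Suc 0"] by blast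
  then have *: "\<forall>q\<in>W. (\<lambda>q. Dm q u) differentiable (at q)" "continuous_on W (\<lambda>q. D2m u q v)"
    unfolding D2m_def Ck_on.simps by blast+
  show "continuous_on W (\<lambda>q. D2m u q v)" by (rule *(2))
  show "((\<lambda>q. Dm q u) has_derivative D2m u q) (at q)" if "q \<in> W"
    using *(1) that unfolding D2m_def by (simp add: frechet_derivative_works)
qed

lemma D2m_symmetric: "D2m u (\<epsilon>, \<epsilon>) v = D2m v (\<epsilon>, \<epsilon>) u"
  by (rule mixed_derivatives_symmetric[OF open_W axis_in_W(1)[OF identity_in_V] Dm_has_derivative
        D2m_has_derivative D2m_has_derivative D2m_continuous D2m_continuous])

lemma right_translation_has_derivative:
  assumes "k \<in> U" shows "(coord_rep c c (\<lambda>h. h \<otimes> k) has_derivative (\<lambda>v. R v (\<phi> k))) (at \<epsilon>)"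
proof -
  have "k \<in> carrier G" using assms U_carrier by blast
  then have "coord_rep c c (\<lambda>h. h \<otimes> k) differentiable (at \<epsilon>)"
    using right_translation_differentiable[OF chart one_in_chart _ chart] assms by simp
  then show ?thesis
    unfolding right_invariant_field_def tangent_map_def iota_phi[OF assms] by (simp add: frechet_derivative_works)
qed

lemma left_translation_has_derivative:
  assumes "k \<in> U" shows "(coord_rep c c (\<lambda>h. k \<otimes> h) has_derivative (\<lambda>v. L v (\<phi> k))) (at \<epsilon>)"
proof -
  have "k \<in> carrier G" using assms U_carrier by blast
  then have "coord_rep c c (\<lambda>h. k \<otimes> h) differentiable (at \<epsilon>)"
    using left_translation_differentiable[OF chart one_in_chart _ chart] assms by simp
  then show ?thesis
    unfolding left_invariant_field_def tangent_map_def iota_phi[OF assms] by (simp add: frechet_derivative_works)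
qed

text \<open>In the chart the invariant fields are partial derivatives of the multiplication along the
  two axes through the identity, for all points of the chart.\<close>
lemma R_eq_Dm: assumes "a \<in> V" shows "R v a = Dm (\<epsilon>, a) (v, 0)"
proof -
  have "(m has_derivative Dm (\<epsilon>, a)) (at (\<epsilon>, \<phi> (\<iota> a)))"
    using Dm_has_derivative[OF axis_in_W(2)[OF assms]] assms by simp
  from right_translation_coord_rep[OF chart one_in_chart chart _ chart _ this]
  have "(coord_rep c c (\<lambda>h. h \<otimes> \<iota> a) has_derivative (\<lambda>v. Dm (\<epsilon>, a) (v, 0))) (at \<epsilon>)"
    using assms by simp
  from has_derivative_unique[OF right_translation_has_derivative[of "\<iota> a"] this]
  show ?thesis using assms by (simp add: fun_eq_iff)
qed

lemma L_eq_Dm: assumes "a \<in> V" shows "L v a = Dm (a, \<epsilon>) (0, v)"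
proof -
  have "(m has_derivative Dm (a, \<epsilon>)) (at (\<phi> (\<iota> a), \<epsilon>))"
    using Dm_has_derivative[OF axis_in_W(1)[OF assms]] assms by simp
  from left_translation_coord_rep[OF chart one_in_chart chart _ chart _ this]
  have "(coord_rep c c (\<lambda>h. \<iota> a \<otimes> h) has_derivative (\<lambda>v. Dm (a, \<epsilon>) (0, v))) (at \<epsilon>)"
    using assms by simp
  from has_derivative_unique[OF left_translation_has_derivative[of "\<iota> a"] this]
  show ?thesis using assms by (simp add: fun_eq_iff)
qed

lemma R_has_derivative:
  assumes "a \<in> V" shows "(R v has_derivative (\<lambda>w. D2m (v, 0) (\<epsilon>, a) (0, w))) (at a)"
proof (rule has_derivative_transform_within_open[OF _ open_V assms])
  have "((\<lambda>a. (\<epsilon>, a)) has_derivative (\<lambda>w. (0, w))) (at a)"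
    by (auto intro!: derivative_eq_intros)
  from has_derivative_compose[OF this D2m_has_derivative[OF axis_in_W(2)[OF assms]]]
  show "((\<lambda>a. Dm (\<epsilon>, a) (v, 0)) has_derivative (\<lambda>w. D2m (v, 0) (\<epsilon>, a) (0, w))) (at a)" .
qed (simp add: R_eq_Dm)

lemma L_has_derivative:
  assumes "a \<in> V" shows "(L v has_derivative (\<lambda>w. D2m (0, v) (a, \<epsilon>) (w, 0))) (at a)"
proof (rule has_derivative_transform_within_open[OF _ open_V assms])
  have "((\<lambda>a. (a, \<epsilon>)) has_derivative (\<lambda>w. (w, 0))) (at a)"
    by (auto intro!: derivative_eq_intros)
  from has_derivative_compose[OF this D2m_has_derivative[OF axis_in_W(1)[OF assms]]]
  show "((\<lambda>a. Dm (a, \<epsilon>) (0, v)) has_derivative (\<lambda>w. D2m (0, v) (a, \<epsilon>) (w, 0))) (at a)" .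
qed (simp add: L_eq_Dm)

lemma R_at_identity: "R v \<epsilon> = v"
proof -
  have "(coord_rep c c (\<lambda>h. h \<otimes> \<one>) has_derivative (\<lambda>v. v)) (at \<epsilon>)"
    by (rule coord_rep_identity[OF chart one_in_chart]) (simp add: U_carrier)
  from has_derivative_unique[OF right_translation_has_derivative[OF one_in_chart] this]
  show ?thesis by (simp add: fun_eq_iff)
qed

lemma L_at_identity: "L v \<epsilon> = v"
proof -
  have "(coord_rep c c (\<lambda>h. \<one> \<otimes> h) has_derivative (\<lambda>v. v)) (at \<epsilon>)"
    by (rule coord_rep_identity[OF chart one_in_chart]) (simp add: U_carrier)
  from has_derivative_unique[OF left_translation_has_derivative[OF one_in_chart] this]
  show ?thesis by (simp add: fun_eq_iff)
qed

lemma bounded_linear_R: "a \<in> V \<Longrightarrow> bounded_linear (\<lambda>v. R v a)"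
  using right_translation_has_derivative[of "\<iota> a"] has_derivative_bounded_linear by fastforce

text \<open>Differentiate \<open>(g h g\<^sup>-\<^sup>1) g = g h\<close> with respect to \<open>h\<close> at the identity.\<close>
lemma R_Ad: assumes g: "g \<in> U" shows "R (Ad G c g v) (\<phi> g) = L v (\<phi> g)"
proof -
  have gc: "g \<in> carrier G" using g U_carrier by blast
  have 1: "g \<otimes> \<one> \<otimes> inv g = \<one>" using gc by simp
  have P: "(coord_rep c c (\<lambda>h. h \<otimes> g) has_derivative (\<lambda>v. R v (\<phi> g))) (at (\<phi> (g \<otimes> \<one> \<otimes> inv g)))"
    using right_translation_has_derivative[OF g] 1 by simp
  have "(coord_rep c c (\<lambda>h. g \<otimes> h) has_derivative (\<lambda>v. R (Ad G c g v) (\<phi> g))) (at \<epsilon>)"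
    by (rule coord_rep_compose[OF chart one_in_chart chart _ conjugation_continuous[OF gc] Ad_has_derivative[OF gc] P])
      (use 1 one_in_chart gc U_carrier in \<open>simp_all add: m_assoc\<close>)
  from has_derivative_unique[OF left_translation_has_derivative[OF g] this]
  show ?thesis by (simp add: fun_eq_iff)
qed

text \<open>The Lipschitz constant is proportional to \<open>norm v\<close>, hence uniform over bounded sets of
  generators; it comes from the finitely many fields of basis vectors.  It serves both the
  differential equation on the group and the remainder in the derivative of \<open>Ad\<close>.\<close>
lemma R_locally_lipschitz:
  obtains r K where "r > 0" "K \<ge> 0" "cball \<epsilon> r \<subseteq> V"
    "\<And>v a b. a \<in> cball \<epsilon> r \<Longrightarrow> b \<in> cball \<epsilon> r \<Longrightarrow> norm (R v a - R v b) \<le> K * norm v * norm (a - b)"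
proof -
  obtain S :: "'e set" where S: "finite S" "span S = UNIV" using finite_dim by blast
  obtain B :: "'e set" and C where B: "finite B" "C \<ge> 0"
    "\<And>(f::'e \<Rightarrow> 'e) x. linear f \<Longrightarrow> norm (f x) \<le> C * (\<Sum>b\<in>B. norm (f b)) * norm x"
    using finite_dim_linear_bound[OF S] by blast
  have cont: "continuous_on V (\<lambda>a. D2m (v, 0) (\<epsilon>, a) (0, w))" for v w
    by (rule continuous_on_compose2[OF D2m_continuous[of "(v, 0)" "(0, w)"]])
      (auto intro!: continuous_intros axis_in_W(2))
  have "\<exists>r>0. \<exists>L\<ge>0. cball \<epsilon> r \<subseteq> V \<and>
      (\<forall>v\<in>B. \<forall>y\<in>cball \<epsilon> r. \<forall>z\<in>cball \<epsilon> r. norm (R v y - R v z) \<le> L * norm (y - z))"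
    by (rule C1_imp_locally_lipschitz_family[OF S B(1) open_V identity_in_V R_has_derivative cont])
  then obtain r M where r: "r > 0" "M \<ge> 0" "cball \<epsilon> r \<subseteq> V"
    "\<And>v y z. v \<in> B \<Longrightarrow> y \<in> cball \<epsilon> r \<Longrightarrow> z \<in> cball \<epsilon> r \<Longrightarrow> norm (R v y - R v z) \<le> M * norm (y - z)"
    by (elim exE conjE) fast
  show thesis
  proof (rule that[OF r(1) _ r(3)])
    show "0 \<le> C * (real (card B) * M)" using B(2) r(2) by simp
    fix v a b assume ab: "a \<in> cball \<epsilon> r" "b \<in> cball \<epsilon> r"
    then have "a \<in> V" "b \<in> V" using r(3) by blast+
    then have "linear (\<lambda>v. R v a - R v b)"
      by (intro linear_compose_sub bounded_linear.linear bounded_linear_R)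
    then have "norm (R v a - R v b) \<le> C * (\<Sum>u\<in>B. norm (R u a - R u b)) * norm v" by (rule B(3))
    also have "\<dots> \<le> C * (\<Sum>u\<in>B. M * norm (a - b)) * norm v"
      by (intro mult_right_mono mult_left_mono sum_mono r(4) ab B(2) norm_ge_zero)
    finally show "norm (R v a - R v b) \<le> C * (real (card B) * M) * norm v * norm (a - b)"
      by (simp add: mult_ac)
  qed
qed

text \<open>Differentiability of \<open>a \<mapsto> Ad v\<close> is read off from \<open>R_Ad\<close> without differentiating
  conjugation twice.  Solving the relation for \<open>Ad v\<close> gives \<open>Ad v = v + (L v - R v) - E\<close>, where
  \<open>E = (R - id)(Ad v - v)\<close> is a product of two factors vanishing at the identity and so does not
  contribute to the derivative.\<close>
theorem Ad_derivative_is_bracket: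
  "((\<lambda>a. Ad G c (\<iota> a) v) has_derivative (\<lambda>w. lie_bracket G c w v)) (at \<epsilon>)"
proof -
  obtain r K where r: "r > 0" "K \<ge> 0" "cball \<epsilon> r \<subseteq> V"
    and lip: "\<And>v a b. a \<in> cball \<epsilon> r \<Longrightarrow> b \<in> cball \<epsilon> r \<Longrightarrow> norm (R v a - R v b) \<le> K * norm v * norm (a - b)"
    using R_locally_lipschitz by blast
  define Aa where "Aa a = Ad G c (\<iota> a) v" for a
  define E where "E a = R (Aa a - v) a - (Aa a - v)" for a
  have e: "Aa \<epsilon> = v" unfolding Aa_def using Ad_one one_in_chart by simp
  have decomp: "Aa a = v + (L v a - R v a) - E a" if "a \<in> V" for a
  proof -
    have "R (Aa a) a = L v a" using R_Ad[of "\<iota> a" v] that unfolding Aa_def by simp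
    then show ?thesis unfolding E_def
      using linear_diff[OF bounded_linear.linear[OF bounded_linear_R[OF that]], of "Aa a" v] by simp
  qed
  have E0: "E \<epsilon> = 0" unfolding E_def by (simp add: R_at_identity)
  have DLR: "((\<lambda>a. L v a - R v a) has_derivative
      (\<lambda>w. D2m (0, v) (\<epsilon>, \<epsilon>) (w, 0) - D2m (v, 0) (\<epsilon>, \<epsilon>) (0, w))) (at \<epsilon>)"
    by (intro has_derivative_diff L_has_derivative R_has_derivative identity_in_V)
  have "(E has_derivative (\<lambda>w. 0)) (at \<epsilon>)"
  proof (rule has_derivative_zeroI[where \<psi> = "\<lambda>a. 2 * K * norm (L v a - R v a)"])
    have "((\<lambda>a. L v a - R v a) \<longlongrightarrow> L v \<epsilon> - R v \<epsilon>) (at \<epsilon>)"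
      using has_derivative_continuous[OF DLR] by (simp add: continuous_within)
    then have "((\<lambda>a. L v a - R v a) \<longlongrightarrow> 0) (at \<epsilon>)"
      by (simp add: R_at_identity L_at_identity)
    then show "((\<lambda>a. 2 * K * norm (L v a - R v a)) \<longlongrightarrow> 0) (at \<epsilon>)"
      by (intro tendsto_mult_right_zero tendsto_norm_zero)
    \<comment> \<open>Within this distance \<open>K * norm (a - \<epsilon>) \<le> 1/2\<close>, so the occurrence of \<open>Ad v - v\<close> in the
      bound for \<open>E\<close> can be absorbed into the left-hand side.\<close>
    define d where "d = min r (1 / (2 * (K + 1)))"
    have d: "d > 0" unfolding d_def using r by simp
    have "norm (E a) \<le> 2 * K * norm (L v a - R v a) * norm (a - \<epsilon>)" if a: "dist a \<epsilon> < d" for a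
    proof -
      have ab: "a \<in> cball \<epsilon> r" "\<epsilon> \<in> cball \<epsilon> r" using a r unfolding d_def by (simp_all add: dist_commute)
      have aV: "a \<in> V" using ab r by blast
      let ?n = "norm (a - \<epsilon>)" and ?x = "norm (Aa a - v)" and ?y = "norm (L v a - R v a)"
      have 1: "norm (E a) \<le> K * ?x * ?n"
        using lip[OF ab, of "Aa a - v"] unfolding E_def by (simp add: R_at_identity)
      have "Aa a - v = (L v a - R v a) - E a" using decomp[OF aV] by simp
      then have "?x \<le> ?y + norm (E a)" by (simp add: norm_triangle_ineq4)
      with 1 have 2: "?x \<le> ?y + (K * ?n) * ?x" by (simp add: mult_ac)
      have "?n \<le> 1 / (2 * (K + 1))" using a unfolding d_def by (simp add: dist_norm)
      then have "K * ?n \<le> K * (1 / (2 * (K + 1)))" using r(2) by (rule mult_left_mono)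
      also have "\<dots> \<le> 1 / 2" using r(2) by (simp add: field_simps)
      finally have "(K * ?n) * ?x \<le> 1 / 2 * ?x" by (rule mult_right_mono) simp
      with 2 have "?x \<le> 2 * ?y" by simp
      then have "K * ?n * ?x \<le> K * ?n * (2 * ?y)" using r(2) by (intro mult_left_mono) auto
      with 1 show ?thesis by (simp add: mult_ac)
    qed
    then show "\<forall>\<^sub>F a in at \<epsilon>. norm (E a) \<le> 2 * K * norm (L v a - R v a) * norm (a - \<epsilon>)"
      unfolding eventually_at using d by blast
  qed (rule E0)
  from has_derivative_diff[OF has_derivative_add[OF has_derivative_const[of v] DLR] this]
  have "((\<lambda>a. v + (L v a - R v a) - E a) has_derivative
      (\<lambda>w. D2m (0, v) (\<epsilon>, \<epsilon>) (w, 0) - D2m (v, 0) (\<epsilon>, \<epsilon>) (0, w))) (at \<epsilon>)" by simp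
  then have "(Aa has_derivative (\<lambda>w. D2m (0, v) (\<epsilon>, \<epsilon>) (w, 0) - D2m (v, 0) (\<epsilon>, \<epsilon>) (0, w))) (at \<epsilon>)"
    by (rule has_derivative_transform_within_open[OF _ open_V identity_in_V]) (simp add: decomp)
  moreover have "D2m (0, v) (\<epsilon>, \<epsilon>) (w, 0) - D2m (v, 0) (\<epsilon>, \<epsilon>) (0, w) = lie_bracket G c w v" for w
  proof -
    have "frechet_derivative (L u) (at \<epsilon>) z = D2m (0, u) (\<epsilon>, \<epsilon>) (z, 0)" for u z
      using frechet_derivative_at[OF L_has_derivative[OF identity_in_V, of u]] by metis
    then show ?thesis
      unfolding lie_bracket_def vector_field_bracket_def L_at_identity
      using D2m_symmetric[of "(v, 0)" "(0, w)"] by simp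
  qed
  ultimately show ?thesis unfolding Aa_def by simp
qed

lemma linear_lie_bracket_left: "linear (\<lambda>w. lie_bracket G c w v)"
  using Ad_derivative_is_bracket has_derivative_linear by blast

lemma lie_bracket_skew: "lie_bracket G c w v = - lie_bracket G c v w"
  by (simp add: lie_bracket_def vector_field_bracket_def)

text \<open>Linearity in the first argument is that of a derivative; skew symmetry moves it to the
  second, which is what evaluates the \<open>Blinfun\<close> in \<open>ad_star\<close>.\<close>
lemma bounded_linear_lie_bracket_right: "bounded_linear (\<lambda>v. lie_bracket G c w v)"
proof -
  obtain S :: "'e set" where S: "finite S" "span S = UNIV" using finite_dim by blast
  have "linear (\<lambda>v. - lie_bracket G c v w)"
    using linear_compose_neg[OF linear_lie_bracket_left] .
  moreover have "(\<lambda>v. lie_bracket G c w v) = (\<lambda>v. - lie_bracket G c v w)"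
    by (rule ext) (rule lie_bracket_skew)
  ultimately have "linear (\<lambda>v. lie_bracket G c w v)" by (simp only:)
  from finite_dim_bounded_linear[OF S this] show ?thesis .
qed

lemma ad_star_apply: "blinfun_apply (ad_star G c w \<mu>) v = blinfun_apply \<mu> (lie_bracket G c w v)"
  unfolding ad_star_def
  by (rule bounded_linear_Blinfun_apply[THEN fun_cong])
    (rule bounded_linear_compose[OF blinfun.bounded_linear_right bounded_linear_lie_bracket_right])

lemma Ad_star_apply:
  assumes "g \<in> carrier G"
  shows "blinfun_apply (Ad_star G c g \<mu>) v = blinfun_apply \<mu> (Ad G c (inv g) v)"
  unfolding Ad_star_def
  by (rule bounded_linear_Blinfun_apply[THEN fun_cong])
    (rule bounded_linear_compose[OF blinfun.bounded_linear_right
        has_derivative_bounded_linear[OF Ad_has_derivative[OF inv_closed[OF assms]]]])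

text \<open>Right translation by \<open>k\<^sup>-\<^sup>1\<close>, where \<open>k\<close> is the point of the curve at time \<open>s\<close>, moves the curve
  to the identity, where its velocity is \<open>- w\<close>.  As \<open>Ad\<^bsub>g\<^esub> = Ad\<^bsub>g k\<^sup>-\<^sup>1\<^esub> Ad\<^sub>k\<close>, the derivative at the
  identity suffices.\<close>
lemma Ad_along_right_invariant_curve:
  assumes a: "(a has_vector_derivative - R w (a s)) (at s within S)" and s: "s \<in> S" "a s \<in> V"
  shows "((\<lambda>\<sigma>. Ad G c (\<iota> (a \<sigma>)) v) has_vector_derivative - lie_bracket G c w (Ad G c (\<iota> (a s)) v)) (at s within S)"
proof -
  define k where "k = \<iota> (a s)"
  have k: "k \<in> U" "k \<in> carrier G" "\<phi> k = a s" using s unfolding k_def by simp_all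
  let ?\<rho> = "coord_rep c c (\<lambda>h. h \<otimes> inv k)"
  have k1: "k \<otimes> inv k \<in> U" using k one_in_chart by simp
  then have "?\<rho> differentiable (at (\<phi> k))"
    using right_translation_differentiable[OF chart k(1) _ chart, of "inv k"] k(2) by simp
  then obtain P where P: "(?\<rho> has_derivative P) (at (a s))"
    unfolding k(3) differentiable_def by blast
  have cancel: "h \<otimes> k \<otimes> inv k = h" if "h \<in> U" for h
    using U_carrier[OF that] k(2) by (simp add: m_assoc)
  have "(coord_rep c c (\<lambda>h. h) has_derivative (\<lambda>v. P (R v (\<phi> k)))) (at \<epsilon>)"
  proof (rule coord_rep_compose[OF chart one_in_chart chart _ right_translation_continuous[OF k(2)]
        right_translation_has_derivative[OF k(1)]])
    show "\<one> \<otimes> k \<in> U" using k by simp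
    show "(?\<rho> has_derivative P) (at (\<phi> (\<one> \<otimes> k)))" using k P by simp
    show "h = h \<otimes> k \<otimes> inv k" if "h \<in> U" for h using cancel[OF that] by (rule sym)
  qed
  from has_derivative_unique[OF this coord_rep_identity[OF chart one_in_chart refl]]
  have "(\<lambda>v. P (R v (\<phi> k))) = (\<lambda>v. v)" .
  \<comment> \<open>Translation by \<open>k\<close> followed by translation by its inverse is the identity, so \<open>P\<close> undoes
    the right-invariant field at \<open>a s\<close>.\<close>
  then have PR: "P (R v (a s)) = v" for v using k(3) by (simp add: fun_eq_iff)
  have linP: "linear P" using P has_derivative_linear by blast
  have \<rho>0: "?\<rho> (a s) = \<epsilon>" using k unfolding k_def[symmetric] by (simp add: k_def[symmetric])
  have "((\<lambda>\<sigma>. ?\<rho> (a \<sigma>)) has_derivative (\<lambda>h. P (h *\<^sub>R (- R w (a s))))) (at s within S)"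
    by (rule has_derivative_compose[OF a[unfolded has_vector_derivative_def] P])
  moreover have "((\<lambda>b. Ad G c (\<iota> b) (Ad G c k v)) has_derivative (\<lambda>u. lie_bracket G c u (Ad G c k v))) (at (?\<rho> (a s)))"
    unfolding \<rho>0 by (rule Ad_derivative_is_bracket)
  ultimately have "((\<lambda>\<sigma>. Ad G c (\<iota> (?\<rho> (a \<sigma>))) (Ad G c k v)) has_derivative
      (\<lambda>h. lie_bracket G c (P (h *\<^sub>R (- R w (a s)))) (Ad G c k v))) (at s within S)"
    by (rule has_derivative_compose)
  moreover have "lie_bracket G c (P (h *\<^sub>R (- R w (a s)))) (Ad G c k v) =
      h *\<^sub>R (- lie_bracket G c w (Ad G c k v))" for h
    using linear_scale[OF linear_lie_bracket_left] linear_neg[OF linear_lie_bracket_left]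
    by (simp add: linear_scale[OF linP] linear_neg[OF linP] PR)
  ultimately have D: "((\<lambda>\<sigma>. Ad G c (\<iota> (?\<rho> (a \<sigma>))) (Ad G c k v)) has_derivative
      (\<lambda>h. h *\<^sub>R (- lie_bracket G c w (Ad G c k v)))) (at s within S)" by simp
  \<comment> \<open>The factorization through \<open>k\<close> holds where the translated point is still covered by the chart,
    hence near time \<open>s\<close>.\<close>
  have tr: "Ad G c (\<iota> (?\<rho> b)) (Ad G c k v) = Ad G c (\<iota> b) v"
    if "\<iota> b \<in> U \<and> \<iota> b \<otimes> inv k \<in> U" for b
  proof -
    have "\<iota> b \<in> carrier G" using that U_carrier by blast
    then show ?thesis using that k(2) by (simp add: Ad_mult[symmetric] m_assoc)
  qed
  have "\<forall>\<^sub>F b in nhds (a s). \<iota> b \<in> U \<and> \<iota> b \<otimes> inv k \<in> U"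
    using eventually_in_chart[OF chart k(1) chart k1 right_translation_continuous] k by simp
  moreover have "(a \<longlongrightarrow> a s) (at s within S)"
    using has_vector_derivative_continuous[OF a] by (simp add: continuous_within)
  ultimately have "\<forall>\<^sub>F \<sigma> in at s within S. \<iota> (a \<sigma>) \<in> U \<and> \<iota> (a \<sigma>) \<otimes> inv k \<in> U"
    by (auto simp: filterlim_iff)
  then have ev: "\<forall>\<^sub>F \<sigma> in at s within S. Ad G c (\<iota> (?\<rho> (a \<sigma>))) (Ad G c k v) = Ad G c (\<iota> (a \<sigma>)) v"
    by eventually_elim (rule tr)
  have "Ad G c (\<iota> (?\<rho> (a s))) (Ad G c k v) = Ad G c (\<iota> (a s)) v"
    by (rule tr) (use k k1 in \<open>simp add: k_def[symmetric]\<close>)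
  from has_derivative_transform_eventually[OF D ev this s(1)] show ?thesis
    unfolding has_vector_derivative_def k_def .
qed

section \<open>Flows of the coadjoint action\<close>

lemma Ad_star_mult:
  assumes "g \<in> carrier G" "k \<in> carrier G"
  shows "Ad_star G c g (Ad_star G c k \<mu>) = Ad_star G c (g \<otimes> k) \<mu>"
  by (rule blinfun_eqI) (use assms in \<open>simp add: Ad_star_apply inv_mult_group Ad_mult\<close>)

lemma Ad_star_one: "Ad_star G c \<one> \<mu> = \<mu>"
  by (rule blinfun_eqI) (simp add: Ad_star_apply Ad_one)

text \<open>The step \<open>\<delta>\<close> depends on the bound \<open>M\<close> for the curve of generators but not on the starting
  time, because the auxiliary curve in the group always starts at the identity.\<close>
lemma coadjoint_flow_short_time:
  assumes M: "M \<ge> 0"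
  obtains \<delta> where "\<delta> > 0"
    "\<And>t\<^sub>0 t\<^sub>1 \<omega> \<mu>. t\<^sub>0 \<le> t\<^sub>1 \<Longrightarrow> t\<^sub>1 - t\<^sub>0 \<le> \<delta> \<Longrightarrow> continuous_on {t\<^sub>0..t\<^sub>1} \<omega> \<Longrightarrow>
      (\<And>t. t \<in> {t\<^sub>0..t\<^sub>1} \<Longrightarrow> norm (\<omega> t) \<le> M) \<Longrightarrow>
      (\<And>t. t \<in> {t\<^sub>0..t\<^sub>1} \<Longrightarrow> (\<mu> has_vector_derivative ad_star G c (\<omega> t) (\<mu> t)) (at t within {t\<^sub>0..t\<^sub>1})) \<Longrightarrow>
      \<exists>g\<in>carrier G. \<mu> t\<^sub>1 = Ad_star G c g (\<mu> t\<^sub>0)"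
proof -
  obtain r K where r: "r > 0" "K \<ge> 0" "cball \<epsilon> r \<subseteq> V"
    and lip: "\<And>v a b. a \<in> cball \<epsilon> r \<Longrightarrow> b \<in> cball \<epsilon> r \<Longrightarrow> norm (R v a - R v b) \<le> K * norm v * norm (a - b)"
    using R_locally_lipschitz by blast
  \<comment> \<open>\<open>N\<close> bounds the field on the ball, as \<open>R w \<epsilon> = w\<close>, and \<open>K * M\<close> is its Lipschitz constant.
    The two terms of \<open>\<delta>\<close> keep the solution in the ball and make the operator a contraction.\<close>
  define N where "N = (1 + K * r) * M"
  have N: "N \<ge> 0" unfolding N_def using r M by simp
  define \<delta> where "\<delta> = min (r / (N + 1)) (1 / (K * M + 1))"
  have KM: "K * M \<ge> 0" using r M by simp
  have \<delta>: "\<delta> > 0" "N * \<delta> \<le> r" "K * M * \<delta> < 1"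
  proof -
    show "\<delta> > 0" unfolding \<delta>_def using r N KM by simp
    have "N * \<delta> \<le> N * (r / (N + 1))" unfolding \<delta>_def using N by (intro mult_left_mono) auto
    also have "\<dots> \<le> r" using N r by (simp add: field_simps)
    finally show "N * \<delta> \<le> r" .
    have "K * M * \<delta> \<le> K * M * (1 / (K * M + 1))" unfolding \<delta>_def using KM by (intro mult_left_mono) auto
    also have "\<dots> < 1" using KM by (simp add: field_simps)
    finally show "K * M * \<delta> < 1" .
  qed
  show thesis
  proof (rule that[OF \<delta>(1)])
    fix t\<^sub>0 t\<^sub>1 :: real and \<omega> :: "real \<Rightarrow> 'e" and \<mu> :: "real \<Rightarrow> 'e \<Rightarrow>\<^sub>L real"
    assume t: "t\<^sub>0 \<le> t\<^sub>1" "t\<^sub>1 - t\<^sub>0 \<le> \<delta>" and \<omega>: "continuous_on {t\<^sub>0..t\<^sub>1} \<omega>"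
      and \<omega>M: "\<And>t. t \<in> {t\<^sub>0..t\<^sub>1} \<Longrightarrow> norm (\<omega> t) \<le> M"
      and \<mu>: "\<And>t. t \<in> {t\<^sub>0..t\<^sub>1} \<Longrightarrow> (\<mu> has_vector_derivative ad_star G c (\<omega> t) (\<mu> t)) (at t within {t\<^sub>0..t\<^sub>1})"
    have ball: "x \<in> V" if "x \<in> cball \<epsilon> r" for x using that r(3) by blast
    obtain a where a: "a t\<^sub>0 = \<epsilon>" "\<And>t. t \<in> {t\<^sub>0..t\<^sub>1} \<Longrightarrow> a t \<in> cball \<epsilon> r"
      "\<And>t. t \<in> {t\<^sub>0..t\<^sub>1} \<Longrightarrow> (a has_vector_derivative - R (\<omega> t) (a t)) (at t within {t\<^sub>0..t\<^sub>1})"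
    proof (rule picard_lindelof[where f = "\<lambda>t x. - R (\<omega> t) x" and x\<^sub>0 = \<epsilon> and r = r
          and L = "K * M" and M = N and t\<^sub>0 = t\<^sub>0 and t\<^sub>1 = t\<^sub>1])
      fix t x y assume "t \<in> {t\<^sub>0..t\<^sub>1}" and xy: "x \<in> cball \<epsilon> r" "y \<in> cball \<epsilon> r"
      then have "K * norm (\<omega> t) * norm (x - y) \<le> K * M * norm (x - y)"
        using \<omega>M r(2) by (intro mult_right_mono mult_left_mono) auto
      then show "norm (- R (\<omega> t) x - - R (\<omega> t) y) \<le> K * M * norm (x - y)"
        using lip[OF xy, of "\<omega> t"] by (simp add: norm_minus_commute)
    next
      fix t x assume t: "t \<in> {t\<^sub>0..t\<^sub>1}" and x: "x \<in> cball \<epsilon> r"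
      have "norm (R (\<omega> t) x - \<omega> t) \<le> K * norm (\<omega> t) * norm (x - \<epsilon>)"
        using lip[OF x, of \<epsilon> "\<omega> t"] r by (simp add: R_at_identity)
      also have "\<dots> \<le> K * M * r"
        using x r M \<omega>M[OF t] by (intro mult_mono mult_left_mono) (auto simp: dist_norm norm_minus_commute)
      finally have "norm (R (\<omega> t) x) \<le> K * M * r + M"
        using \<omega>M[OF t] norm_triangle_sub[of "R (\<omega> t) x" "\<omega> t"] by linarith
      then show "norm (- R (\<omega> t) x) \<le> N" unfolding N_def by (simp add: algebra_simps)
    next
      fix x assume "x \<in> cball \<epsilon> r"
      then show "continuous_on {t\<^sub>0..t\<^sub>1} (\<lambda>t. - R (\<omega> t) x)"
        by (intro continuous_intros bounded_linear.continuous_on[OF bounded_linear_R] \<omega> ball)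
    next
      show "N * (t\<^sub>1 - t\<^sub>0) \<le> r" using mult_left_mono[OF t(2) N] \<delta>(2) by linarith
      show "K * M * (t\<^sub>1 - t\<^sub>0) < 1" using mult_left_mono[OF t(2) KM] \<delta>(3) by linarith
    qed (use t r KM in auto)
    define h where "h s = \<iota> (a s)" for s
    have h: "h s \<in> carrier G" if "s \<in> {t\<^sub>0..t\<^sub>1}" for s
      unfolding h_def using ball[OF a(2)[OF that]] by simp
    have const: "blinfun_apply (\<mu> t\<^sub>1) (Ad G c (h t\<^sub>1) v) = blinfun_apply (\<mu> t\<^sub>0) v" for v
    proof -
      have "((\<lambda>s. blinfun_apply (\<mu> s) (Ad G c (h s) v)) has_derivative (\<lambda>_. 0)) (at s within {t\<^sub>0..t\<^sub>1})"
        if s: "s \<in> {t\<^sub>0..t\<^sub>1}" for s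
      proof -
        \<comment> \<open>The two terms of the product rule cancel.\<close>
        have "((\<lambda>s. blinfun_apply (\<mu> s) (Ad G c (h s) v)) has_vector_derivative
            blinfun_apply (\<mu> s) (- lie_bracket G c (\<omega> s) (Ad G c (h s) v)) +
            blinfun_apply (ad_star G c (\<omega> s) (\<mu> s)) (Ad G c (h s) v)) (at s within {t\<^sub>0..t\<^sub>1})"
          unfolding h_def
          by (intro blinfun.has_vector_derivative \<mu>[OF s]
              Ad_along_right_invariant_curve[OF a(3)[OF s] s ball[OF a(2)[OF s]]])
        then show ?thesis by (simp add: ad_star_apply has_vector_derivative_def blinfun.minus_right)
      qed
      from has_derivative_zero_constant[OF convex_real_interval(5) this]
      obtain C where C: "\<And>s. s \<in> {t\<^sub>0..t\<^sub>1} \<Longrightarrow> blinfun_apply (\<mu> s) (Ad G c (h s) v) = C" by blast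
      have "h t\<^sub>0 = \<one>" unfolding h_def a(1) using one_in_chart by simp
      then show ?thesis using C[of t\<^sub>0] C[of t\<^sub>1] t(1) by (simp add: Ad_one)
    qed
    have h1: "h t\<^sub>1 \<in> carrier G" using h t(1) by simp
    have "\<mu> t\<^sub>1 = Ad_star G c (h t\<^sub>1) (\<mu> t\<^sub>0)"
    proof (rule blinfun_eqI)
      fix v
      have "Ad G c (h t\<^sub>1) (Ad G c (inv h t\<^sub>1) v) = v"
        using h1 by (simp add: Ad_mult[symmetric] Ad_one)
      then show "blinfun_apply (\<mu> t\<^sub>1) v = blinfun_apply (Ad_star G c (h t\<^sub>1) (\<mu> t\<^sub>0)) v"
        using const[of "Ad G c (inv h t\<^sub>1) v"] by (simp add: Ad_star_apply[OF h1])
    qed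
    with h1 show "\<exists>g\<in>carrier G. \<mu> t\<^sub>1 = Ad_star G c g (\<mu> t\<^sub>0)" by blast
  qed
qed

text \<open>On \<open>[0, t]\<close> the generators are bounded, so one step length serves throughout; the group
  elements of the steps multiply.\<close>
theorem coadjoint_flow_in_orbit:
  assumes t: "0 \<le> t" and \<omega>: "continuous_on {0..t} \<omega>"
    and \<mu>: "\<And>s. s \<in> {0..t} \<Longrightarrow> (\<mu> has_vector_derivative ad_star G c (\<omega> s) (\<mu> s)) (at s within {0..t})"
  shows "\<mu> t \<in> coadjoint_orbit G c (\<mu> 0)"
proof -
  have "bounded (\<omega> ` {0..t})"
    using \<omega> by (intro compact_imp_bounded compact_continuous_image) auto
  then obtain M where M: "M > 0" "\<And>s. s \<in> {0..t} \<Longrightarrow> norm (\<omega> s) \<le> M"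
    unfolding bounded_pos by auto
  obtain \<delta> where \<delta>: "\<delta> > 0"
    "\<And>t\<^sub>0 t\<^sub>1 \<omega> \<mu>. t\<^sub>0 \<le> t\<^sub>1 \<Longrightarrow> t\<^sub>1 - t\<^sub>0 \<le> \<delta> \<Longrightarrow> continuous_on {t\<^sub>0..t\<^sub>1} \<omega> \<Longrightarrow>
      (\<And>t. t \<in> {t\<^sub>0..t\<^sub>1} \<Longrightarrow> norm (\<omega> t) \<le> M) \<Longrightarrow>
      (\<And>t. t \<in> {t\<^sub>0..t\<^sub>1} \<Longrightarrow> (\<mu> has_vector_derivative ad_star G c (\<omega> t) (\<mu> t)) (at t within {t\<^sub>0..t\<^sub>1})) \<Longrightarrow>
      \<exists>g\<in>carrier G. \<mu> t\<^sub>1 = Ad_star G c g (\<mu> t\<^sub>0)"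
    using coadjoint_flow_short_time[of M] M(1) by (metis less_imp_le)
  have reach: "\<exists>g\<in>carrier G. \<mu> s = Ad_star G c g (\<mu> 0)" if "s \<in> {0..t}" "s \<le> real n * \<delta>" for n s
    using that
  proof (induction n arbitrary: s)
    case 0
    then have "s = 0" by simp
    then show ?case using Ad_star_one by (metis one_closed)
  next
    case (Suc n)
    define s\<^sub>0 where "s\<^sub>0 = max 0 (s - \<delta>)"
    have s0: "s\<^sub>0 \<in> {0..t}" "s\<^sub>0 \<le> s" "s - s\<^sub>0 \<le> \<delta>" "s\<^sub>0 \<le> real n * \<delta>"
      using Suc.prems \<delta>(1) unfolding s\<^sub>0_def by (auto simp: algebra_simps)
    obtain k where k: "k \<in> carrier G" "\<mu> s\<^sub>0 = Ad_star G c k (\<mu> 0)" using Suc.IH[OF s0(1,4)] by blast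
    have sub: "{s\<^sub>0..s} \<subseteq> {0..t}" using s0 Suc.prems by auto
    have "\<exists>g\<in>carrier G. \<mu> s = Ad_star G c g (\<mu> s\<^sub>0)"
    proof (rule \<delta>(2)[OF s0(2,3)])
      show "continuous_on {s\<^sub>0..s} \<omega>" using \<omega> sub by (rule continuous_on_subset)
      fix u assume "u \<in> {s\<^sub>0..s}"
      then have u: "u \<in> {0..t}" using sub by blast
      show "norm (\<omega> u) \<le> M" by (rule M(2)[OF u])
      show "(\<mu> has_vector_derivative ad_star G c (\<omega> u) (\<mu> u)) (at u within {s\<^sub>0..s})"
        using \<mu>[OF u] sub by (rule has_vector_derivative_within_subset)
    qed
    then obtain g where "g \<in> carrier G" "\<mu> s = Ad_star G c g (\<mu> s\<^sub>0)" by blast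
    with k show ?case by (intro bexI[of _ "g \<otimes> k"]) (simp_all add: Ad_star_mult)
  qed
  obtain n where "t / \<delta> \<le> real n" using real_arch_simple by blast
  then have "t \<le> real n * \<delta>" using \<delta>(1) by (simp add: field_simps)
  then obtain g where "g \<in> carrier G" "\<mu> t = Ad_star G c g (\<mu> 0)" using reach[of t n] t by auto
  then show ?thesis unfolding coadjoint_orbit_def by blast
qed

lemma ad_star_add: "ad_star G c (u + w) \<mu> = ad_star G c u \<mu> + ad_star G c w \<mu>"
  by (rule blinfun_eqI)
    (simp add: ad_star_apply blinfun.add_left blinfun.add_right linear_add[OF linear_lie_bracket_left])

end

section \<open>Euler-Poincare equations with forcing with delay\<close>

text \<open>The force \<open>ad\<^sup>*\<^bsub>\<eta>\<^esub> \<mu>\<close> joins the term \<open>ad\<^sup>*\<^bsub>\<xi>\<^esub> \<mu>\<close>; the sum \<open>\<omega> = \<xi> + \<eta>\<close> is continuous along the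
  solution because the delayed argument stays in \<open>[-\<tau>, \<alpha>)\<close>.  The orbit is that of \<open>\<mu>(0)\<close>.\<close>
theorem corollary5p3:
  fixes G :: "('g, 'x) monoid_scheme"
    and T :: "'g topology"
    and A :: "('g, 'e::banach) chart set"
    and c :: "('g, 'e) chart"
    and l :: "'e \<Rightarrow> real"
    and f :: "'e \<times> 'e \<Rightarrow> ('e \<Rightarrow>\<^sub>L real)"
    and \<eta> :: "'e \<times> 'e \<Rightarrow> 'e"
    and \<tau> \<alpha> :: real
    and \<xi> :: "real \<Rightarrow> 'e"
  assumes "lie_group G T A"
    and "c \<in> A" and "\<one>\<^bsub>G\<^esub> \<in> fst c"
    and "smooth_on UNIV l"
    and "smooth_on UNIV \<eta>"
    and "\<And>x y. f (x, y) = ad_star G c (\<eta> (x, y)) (momentum l x)"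
    and "\<tau> \<ge> 0" and "\<alpha> > 0"
    and "euler_poincare_delay_solution G c l f \<tau> \<alpha> \<xi>"
  shows "\<exists>\<mu>\<^sub>0. \<forall>t\<in>{0..<\<alpha>}. momentum l (\<xi> t) \<in> coadjoint_orbit G c \<mu>\<^sub>0"
proof -
  interpret lie_group_chart G T A c
    using assms(1-3) by (simp add: lie_group_chart_def lie_group_chart_axioms_def)
  define \<mu> where "\<mu> = (\<lambda>t. momentum l (\<xi> t))"
  define \<omega> where "\<omega> t = \<xi> t + \<eta> (\<xi> t, \<xi> (t - \<tau>))" for t
  have \<xi>: "continuous_on {-\<tau>..<\<alpha>} \<xi>"
    using assms(9) unfolding euler_poincare_delay_solution_def by blast
  have "Ck_on 0 UNIV \<eta>" using assms(5) unfolding smooth_on_def by blast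
  then have \<eta>: "continuous_on UNIV \<eta>" by simp
  have \<xi>1: "continuous_on {0..<\<alpha>} \<xi>"
    by (rule continuous_on_subset[OF \<xi>]) (use assms(7) in auto)
  have \<xi>2: "continuous_on {0..<\<alpha>} (\<lambda>t. \<xi> (t - \<tau>))"
    by (rule continuous_on_compose2[OF \<xi>]) (use assms(7) in \<open>auto intro!: continuous_intros\<close>)
  have \<omega>: "continuous_on {0..<\<alpha>} \<omega>"
    unfolding \<omega>_def
    by (intro continuous_on_add \<xi>1 continuous_on_compose2[OF \<eta>] continuous_on_Pair \<xi>2) auto
  have \<mu>: "(\<mu> has_vector_derivative ad_star G c (\<omega> t) (\<mu> t)) (at t within {0..<\<alpha>})"
    if t: "t \<in> {0..<\<alpha>}" for t
  proof -
    obtain D where D: "(\<mu> has_vector_derivative D) (at t within {0..<\<alpha>})"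
      "D - ad_star G c (\<xi> t) (\<mu> t) = f (\<xi> t, \<xi> (t - \<tau>))"
      using assms(9) t unfolding euler_poincare_delay_solution_def \<mu>_def by blast
    have "D = ad_star G c (\<xi> t) (\<mu> t) + f (\<xi> t, \<xi> (t - \<tau>))"
      using D(2) by (simp add: algebra_simps)
    also have "\<dots> = ad_star G c (\<omega> t) (\<mu> t)"
      unfolding assms(6) \<omega>_def ad_star_add \<mu>_def ..
    finally show ?thesis using D(1) by simp
  qed
  have "\<mu> t \<in> coadjoint_orbit G c (\<mu> 0)" if t: "t \<in> {0..<\<alpha>}" for t
  proof (rule coadjoint_flow_in_orbit[where \<omega> = \<omega>])
    have sub: "{0..t} \<subseteq> {0..<\<alpha>}" using t by auto
    show "0 \<le> t" using t by simp
    show "continuous_on {0..t} \<omega>" using \<omega> sub by (rule continuous_on_subset)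
    fix s assume "s \<in> {0..t}"
    then have "s \<in> {0..<\<alpha>}" using sub by blast
    from \<mu>[OF this] sub
    show "(\<mu> has_vector_derivative ad_star G c (\<omega> s) (\<mu> s)) (at s within {0..t})"
      by (rule has_vector_derivative_within_subset)
  qed
  then show ?thesis unfolding \<mu>_def by blast
qed

end
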